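(* Let $k\ge 2$ be an integer. If $d\ge e^3(k-1)$, where $e$ is the base of the natural logarithm, then every $d$-regular digraph contains pairwise edge-disjoint directed cycles $C_2,C_3,\ldots,C_k$ such that the length of $C_r$ is divisible by $r$ for every $2\le r\le k$.
   Context: All digraphs are finite, nonempty, simple and loopless: for each ordered pair $(u,v)$ there is at most one edge from $u$ to $v$, there are no edges from a vertex to itself, and both opposite edges $uv$ and $vu$ may be present. A digraph is $d$-regular if every vertex has outdegree $d$ and indegree $d$. A directed cycle $C=v_1v_2\cdots v_\ell v_1$ has distinct vertices $v_1,\dots,v_\ell$ and all displayed edges in the digraph (so $\ell\ge 2$); its length is $\ell$. *)

theory Defs
  imports Complex_Main "HOL-Library.Disjoint_Sets" "Graph_Theory.Graph_Theory"
begin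

text \<open>
  The locale \<^locale>\<open>digraph\<close> provides finiteness, absence of loops and absence of parallel
  arcs (opposite arcs are allowed), but it admits the empty vertex set. Every graph without
  vertices would vacuously be regular of every degree, so nonemptiness is required explicitly.
\<close>

definition regular_digraph :: "nat \<Rightarrow> ('a, 'b) pre_digraph \<Rightarrow> bool" where
  "regular_digraph d G \<longleftrightarrow>
     digraph G \<and> verts G \<noteq> {} \<and>
     (\<forall>v \<in> verts G. out_degree G v = d \<and> in_degree G v = d)"

end

theory Submission
  imports
    Defs
    "HOL-Combinatorics.Cycles"
    "HOL-Computational_Algebra.Fundamental_Theorem_Algebra"
    "HOL-Analysis.Complex_Transcendental"
    "Jordan_Normal_Form.Determinant"
begin

text \<open>
  The cycles are removed greedily. If some of them have been removed and the rest has no cycle of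
  length divisible by \<open>r\<close>, add to each vertex as many loops as removed cycles pass through it; the
  resulting matrix has all row and column sums \<open>d\<close>, so its permanent is at least \<open>(d/e)^n\<close>
  by Gurvits' capacity argument. For an upper bound, consider a permutation of a vertex set \<open>T\<close>
  along arcs. Over the nontrivial \<open>r\<close>-th roots of unity \<open>z\<close> we have \<open>\<Sum> z ^ l = -1\<close> for each of
  its cycle lengths \<open>l\<close>, so its sign is, up to \<open>(-1) ^ card T\<close>, the sum of the products of all
  colourings of \<open>T\<close> by these roots that are constant on its cycles. Hence the number of such
  permutations is bounded by the sum, over all colourings, of the absolute values of the determinants
  of the adjacency matrices restricted to monochromatic arcs. Hadamard's inequality, the
  Cauchy-Schwarz inequality and a count of functional digraphs weighted by \<open>r - 1\<close> to the number of
  cycles bound this by \<open>sqrt (2 d (r - 1)) ^ card T\<close>. Including the loops, the permanent is less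
  than \<open>(k - 1 + sqrt (2 d (k - 1)))^n\<close>, which is at most \<open>(d/e)^n\<close>.
\<close>

section \<open>Gurvits' lower bound for permanents\<close>

lemma coeff_linear_factor_mult:
  fixes P :: "'a :: comm_ring_1 poly"
  shows "coeff ([:- a, 1:] * P) 0 = - a * coeff P 0"
    "coeff ([:- a, 1:] * P) 1 = - a * coeff P 1 + coeff P 0"
  by (simp_all add: mult_pCons_left)

text \<open>The quotient is the logarithmic derivative at 0, the sum of \<open>inverse (- x)\<close>
  over the roots, and each term has positive real part.\<close>

lemma log_derivative_positive:
  assumes "\<forall>x\<in>#A. Re x < 0"
  defines "P \<equiv> (\<Prod>x\<in>#A. [:- x, 1:])"
  shows "coeff P 0 \<noteq> 0" "A \<noteq> {#} \<Longrightarrow> Re (coeff P 1 / coeff P 0) > 0"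
proof -
  have "coeff P 0 \<noteq> 0 \<and> Re (coeff P 1 / coeff P 0) \<ge> 0 \<and> (A \<noteq> {#} \<longrightarrow> Re (coeff P 1 / coeff P 0) > 0)"
    using assms(1) unfolding P_def
  proof (induction A)
    case (add a A)
    let ?P = "\<Prod>x\<in>#A. [:- x, 1:]"
    have a: "Re a < 0" "a \<noteq> 0" using add.prems by auto
    have IH: "coeff ?P 0 \<noteq> 0" "Re (coeff ?P 1 / coeff ?P 0) \<ge> 0" using add by auto
    have "Re (inverse (- a)) > 0"
      using a by (simp add: complex_inverse inverse_complex.sel divide_neg_pos sum_power2_gt_zero_iff complex_eq_iff add_pos_nonneg)
    moreover have "coeff ([:- a, 1:] * ?P) 1 / coeff ([:- a, 1:] * ?P) 0
        = coeff ?P 1 / coeff ?P 0 + inverse (- a)"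
      unfolding coeff_linear_factor_mult using a IH(1) by (simp add: field_simps)
    ultimately show ?case
      using IH a by (simp add: coeff_linear_factor_mult)
  qed simp
  then show "coeff P 0 \<noteq> 0" "A \<noteq> {#} \<Longrightarrow> Re (coeff P 1 / coeff P 0) > 0"
    by auto
qed

text \<open>Applied to one variable at a time, this carries stability over to linear coefficients:
  all roots have negative real part, so the logarithmic derivative at 0 cannot vanish.\<close>

lemma coeff_1_stable_neq_0:
  fixes g :: "complex poly"
  assumes "degree g > 0" and "\<And>t. Re t \<ge> 0 \<Longrightarrow> poly g t \<noteq> 0"
  shows "coeff g 1 \<noteq> 0"
proof -
  have "g \<noteq> 0" using assms(1) by auto
  obtain A where A: "size A = degree g" "g = Polynomial.smult (lead_coeff g) (\<Prod>x\<in>#A. [:- x, 1:])"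
    using alg_closed_imp_factorization [OF \<open>g \<noteq> 0\<close>] by blast
  let ?P = "\<Prod>x\<in>#A. [:- x, 1:]"
  have "Re x < 0" if "x \<in># A" for x
  proof -
    have "poly ?P x = 0" using that by (simp add: poly_prod_mset prod_mset_zero_iff)
    then have "poly g x = 0" by (subst A(2)) simp
    then show ?thesis using assms(2) [of x] by force
  qed
  moreover have "A \<noteq> {#}" using A(1) assms(1) by auto
  ultimately have "coeff ?P 1 \<noteq> 0" using log_derivative_positive [of A] by fastforce
  then show ?thesis using \<open>g \<noteq> 0\<close> by (subst A(2)) simp
qed

text \<open>Each factor satisfies \<open>s + t \<le> s * exp (t / s)\<close> with
  \<open>s = - Re x\<close>; the bound is the product of these. The witnesses are real because the
  values of a complex polynomial cannot be compared directly.\<close>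

lemma prod_linear_le_exp:
  assumes "\<forall>x\<in>#A. Im x = 0 \<and> Re x < 0" and "t \<ge> (0::real)"
  shows "\<exists>a b v. coeff (\<Prod>x\<in>#A. [:- x, 1:]) 0 = of_real a \<and> coeff (\<Prod>x\<in>#A. [:- x, 1:]) 1 = of_real b \<and>
    poly (\<Prod>x\<in>#A. [:- x, 1:]) (of_real t) = of_real v \<and> a > 0 \<and> 0 \<le> v \<and> v \<le> a * exp (t * (b / a))"
  using assms(1)
proof (induction A)
  case (add x A)
  let ?P = "\<Prod>x\<in>#A. [:- x, 1:]"
  obtain a b v where IH: "coeff ?P 0 = of_real a" "coeff ?P 1 = of_real b"
    "poly ?P (of_real t) = of_real v" "a > 0" "0 \<le> v" "v \<le> a * exp (t * (b / a))"
    using add by auto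
  define s where "s = - Re x"
  have s: "s > 0" and x: "- x = of_real s" using add.prems by (auto simp: s_def complex_eq_iff)
  have "s * v + t * v = s * (1 + t / s) * v" using s by (simp add: field_simps)
  also have "\<dots> \<le> s * exp (t / s) * (a * exp (t * (b / a)))"
    using IH(5,6) s assms(2) by (intro mult_mono mult_left_mono exp_ge_add_one_self) auto
  also have "\<dots> = s * a * exp (t * ((s * b + a) / (s * a)))"
    using s IH(4) by (simp add: mult_exp_exp field_simps)
  finally have "s * v + t * v \<le> s * a * exp (t * ((s * b + a) / (s * a)))" .
  moreover have "coeff ([:- x, 1:] * ?P) 0 = of_real (s * a)" "coeff ([:- x, 1:] * ?P) 1 = of_real (s * b + a)"
    unfolding coeff_linear_factor_mult by (simp_all add: IH IH(2) [unfolded One_nat_def] x)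
  moreover have "poly ([:- x, 1:] * ?P) (of_real t) = of_real (s * v + t * v)"
    by (simp add: IH x algebra_simps)
  ultimately show ?case
    using s IH(4,5) assms(2)
    by (intro exI [of _ "s * a"] exI [of _ "s * b + a"] exI [of _ "s * v + t * v"]) simp
qed auto

text \<open>The univariate core of Gurvits' argument: \<open>K * t\<close> is at most
  \<open>g0 * exp (t * (g1 / g0))\<close> for all positive \<open>t\<close>, and the best
  \<open>t\<close> leaves a loss of the factor e.\<close>

lemma coeff_1_capacity:
  fixes g :: "complex poly"
  assumes deg: "degree g > 0" and roots: "\<And>t. poly g t = 0 \<Longrightarrow> Im t = 0 \<and> Re t < 0"
    and g0: "coeff g 0 = of_real g0" "g0 > 0" and g1: "coeff g 1 = of_real g1"
    and K: "\<And>t. t > 0 \<Longrightarrow> K * t \<le> Re (poly g (of_real t))"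
  shows "K \<le> exp 1 * g1"
proof -
  have "g \<noteq> 0" using deg by auto
  obtain A where A: "size A = degree g" "g = Polynomial.smult (lead_coeff g) (\<Prod>x\<in>#A. [:- x, 1:])"
    using alg_closed_imp_factorization [OF \<open>g \<noteq> 0\<close>] by blast
  let ?P = "\<Prod>x\<in>#A. [:- x, 1:]"
  let ?c = "lead_coeff g"
  have neg: "\<forall>x\<in>#A. Im x = 0 \<and> Re x < 0"
  proof
    fix x assume "x \<in># A"
    then have "poly ?P x = 0" by (simp add: poly_prod_mset prod_mset_zero_iff)
    then have "poly g x = 0" by (subst A(2)) simp
    then show "Im x = 0 \<and> Re x < 0" by (rule roots)
  qed
  have "A \<noteq> {#}" using A(1) deg by auto
  have c: "coeff g n = ?c * coeff ?P n" "poly g t = ?c * poly ?P t" for n t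
    by (subst A(2), simp)+
  have bound: "0 < a \<and> ?c = of_real (g0 / a) \<and> b > 0 \<and> g1 = g0 * (b / a)"
    if "coeff ?P 0 = of_real a" "coeff ?P 1 = of_real b" "a > 0" for a b
  proof -
    have "?c * of_real a = of_real g0" using c(1) [of 0] g0 that by simp
    then have "?c = of_real (g0 / a)" using that by (simp add: field_simps)
    moreover have "b > 0"
      using log_derivative_positive(2) [of A] neg \<open>A \<noteq> {#}\<close> that by (simp add: zero_less_divide_iff)
    moreover have "of_real g1 = (of_real (g0 / a * b) :: complex)"
      using c(1) [of 1] g1 that calculation(1) by simp
    then have "g1 = g0 * (b / a)" by (simp only: of_real_eq_iff) simp
    ultimately show ?thesis using that by simp
  qed
  obtain a b where ab: "coeff ?P 0 = of_real a" "coeff ?P 1 = of_real b" "a > 0"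
    using prod_linear_le_exp [OF neg order_refl] by blast
  have "g1 > 0" using bound [OF ab] g0 by simp
  \<comment> \<open>This choice minimises \<open>g0 * exp (t * (g1 / g0)) / t\<close>; the exponent
    becomes 1.\<close>
  define t where "t = g0 / g1"
  have t: "t > 0" using g0 \<open>g1 > 0\<close> by (simp add: t_def)
  obtain a' b' v where v: "coeff ?P 0 = of_real a'" "coeff ?P 1 = of_real b'"
      "poly ?P (of_real t) = of_real v" "a' > 0" "v \<le> a' * exp (t * (b' / a'))"
    using prod_linear_le_exp [OF neg, of t] t by auto
  note ab' = bound [OF v(1,2,4)]
  have "t * (b' / a') = 1"
    using ab' g0 by (simp add: t_def)
  with v(5) have "v \<le> a' * exp 1" by (simp only:)
  have "K * t \<le> Re (poly g (of_real t))" using K t by simp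
  also have "\<dots> = g0 / a' * v" using c(2) [of "of_real t"] v ab' by simp
  also have "\<dots> \<le> g0 / a' * (a' * exp 1)"
    using \<open>v \<le> a' * exp 1\<close> g0 v(4) by (intro mult_left_mono) auto
  also have "\<dots> = exp 1 * g1 * t"
    using v(4) \<open>g1 > 0\<close> by (simp add: t_def)
  finally show ?thesis using t by simp
qed

lemma weighted_am_gm:
  fixes x :: "'a \<Rightarrow> real"
  assumes "finite V" "\<And>j. j \<in> V \<Longrightarrow> b j \<ge> 0" "(\<Sum>j\<in>V. b j) = 1" "\<And>j. j \<in> V \<Longrightarrow> x j > 0"
  shows "exp (\<Sum>j\<in>V. b j * ln (x j)) \<le> (\<Sum>j\<in>V. b j * x j)"
proof -
  define m where "m = (\<Sum>j\<in>V. b j * ln (x j))"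
  \<comment> \<open>The bracket equals 1. In this form the right-hand side is the average, with
    weights \<open>b j\<close>, of the tangent to \<open>exp\<close> at \<open>m\<close>, evaluated
    at \<open>ln (x j)\<close>.\<close>
  have "exp m = exp m * ((\<Sum>j\<in>V. b j) + m - m * (\<Sum>j\<in>V. b j))" using assms(3) by simp
  also have "\<dots> = (\<Sum>j\<in>V. b j * (exp m * (1 + (ln (x j) - m))))"
    by (simp add: m_def [symmetric] algebra_simps sum.distrib sum_subtractf sum_distrib_left)
       (simp add: m_def algebra_simps sum_distrib_left sum_distrib_right)
  also have "\<dots> \<le> (\<Sum>j\<in>V. b j * x j)"
  proof (intro sum_mono mult_left_mono assms)
    fix j assume "j \<in> V"
    have "exp m * (1 + (ln (x j) - m)) \<le> exp m * exp (ln (x j) - m)"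
      by (intro mult_left_mono exp_ge_add_one_self) simp
    also have "\<dots> = x j" using assms(4) [OF \<open>j \<in> V\<close>] by (simp add: mult_exp_exp)
    finally show "exp m * (1 + (ln (x j) - m)) \<le> x j" .
  qed
  finally show ?thesis by (simp add: m_def)
qed

section \<open>Multilinear coefficients of a product of linear forms\<close>

lemma prod_monom:
  fixes a :: "'a \<Rightarrow> 'b :: comm_semiring_1"
  assumes "finite S"
  shows "(\<Prod>i\<in>S. if P i then 1 else if R i then [:0, 1:] else [:a i:])
    = monom (\<Prod>i\<in>S. if P i \<or> R i then 1 else a i) (card {i \<in> S. \<not> P i \<and> R i})"
  using assms
proof (induction S)
  case empty
  show ?case by (simp add: monom_0)
next
  case (insert x S)
  have *: "{i \<in> insert x S. \<not> P i \<and> R i}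
      = (if \<not> P x \<and> R x then insert x {i \<in> S. \<not> P i \<and> R i} else {i \<in> S. \<not> P i \<and> R i})"
    by auto
  show ?case
    unfolding prod.insert [OF insert.hyps] insert.IH *
    using insert.hyps by (auto simp: monom_Suc mult_pCons_left smult_monom)
qed

text \<open>A map picks one term from each factor of
  \<open>\<Prod>i\<in>V. \<Sum>j\<in>V. b i j * z j\<close>; kept are the picks whose monomial has
  degree one in every variable of \<open>U\<close>. For \<open>U = V\<close> these are the
  permutations of \<open>V\<close>.\<close>

definition fibre_maps :: "'a set \<Rightarrow> 'a set \<Rightarrow> ('a \<Rightarrow> 'a) set" where
  "fibre_maps V U = {f \<in> V \<rightarrow>\<^sub>E V. \<forall>u\<in>U. card {i \<in> V. f i = u} = 1}"

text \<open>
  \<open>marginal V b U z\<close> is the coefficient of \<open>\<Prod>u\<in>U. z u\<close> in the polynomial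
  \<open>\<Prod>i\<in>V. \<Sum>j\<in>V. b i j * z j\<close>, as a polynomial in the remaining variables.
\<close>

definition marginal :: "'a set \<Rightarrow> ('a \<Rightarrow> 'a \<Rightarrow> real) \<Rightarrow> 'a set \<Rightarrow> ('a \<Rightarrow> complex) \<Rightarrow> complex" where
  "marginal V b U z = (\<Sum>f\<in>fibre_maps V U. of_real (\<Prod>i\<in>V. b i (f i)) * (\<Prod>i\<in>V. if f i \<in> U then 1 else z (f i)))"

definition marginal_poly ::
  "'a set \<Rightarrow> ('a \<Rightarrow> 'a \<Rightarrow> real) \<Rightarrow> 'a set \<Rightarrow> 'a \<Rightarrow> ('a \<Rightarrow> complex) \<Rightarrow> complex poly" where
  "marginal_poly V b U v z = (\<Sum>f\<in>fibre_maps V U. Polynomial.smult (of_real (\<Prod>i\<in>V. b i (f i)))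
    (monom (\<Prod>i\<in>V. if f i \<in> U \<or> f i = v then 1 else z (f i)) (card {i \<in> V. f i \<notin> U \<and> f i = v})))"

lemma poly_marginal_poly:
  assumes "finite V"
  shows "poly (marginal_poly V b U v z) t = marginal V b U (z(v := t))"
proof -
  have "poly (monom (\<Prod>i\<in>V. if f i \<in> U \<or> f i = v then 1 else z (f i)) (card {i \<in> V. f i \<notin> U \<and> f i = v})) t
      = (\<Prod>i\<in>V. if f i \<in> U then 1 else (z(v := t)) (f i))" for f
    by (subst prod_monom [OF assms, symmetric]) (auto simp: poly_prod intro!: prod.cong)
  then show ?thesis
    by (simp add: marginal_poly_def marginal_def poly_sum)
qed

text \<open>A summand is linear in the variable of \<open>v\<close> exactly if its map takes the
  value \<open>v\<close> once. Thus vertices can join \<open>U\<close> one at a time.\<close>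

lemma coeff_1_marginal_poly:
  assumes "finite V" "v \<notin> U"
  shows "coeff (marginal_poly V b U v z) 1 = marginal V b (insert v U) z"
proof -
  have fin: "finite (fibre_maps V U)"
    using assms(1) by (simp add: fibre_maps_def finite_PiE)
  have "{i \<in> V. f i \<notin> U \<and> f i = v} = {i \<in> V. f i = v}" for f
    using assms(2) by auto
  then have "fibre_maps V (insert v U) = {f \<in> fibre_maps V U. card {i \<in> V. f i \<notin> U \<and> f i = v} = 1}"
    by (auto simp: fibre_maps_def)
  moreover have "(f i \<in> U \<or> f i = v) = (f i \<in> insert v U)" for f and i :: 'a by auto
  ultimately show ?thesis
    unfolding marginal_poly_def marginal_def coeff_sum
    by (simp add: sum.inter_filter [OF fin] del: One_nat_def cong: if_cong) (rule sum.cong, auto)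
qed

lemma card_fibres:
  assumes "finite V" "U \<subseteq> V" "f \<in> fibre_maps V U"
  shows "card {i \<in> V. f i \<in> U} = card U"
proof -
  have "finite U" using assms finite_subset by auto
  have "{i \<in> V. f i \<in> U} = (\<Union>u\<in>U. {i \<in> V. f i = u})" by auto
  also have "card \<dots> = (\<Sum>u\<in>U. card {i \<in> V. f i = u})"
    by (rule card_UN_disjoint) (use assms \<open>finite U\<close> in auto)
  also have "\<dots> = card U" using assms(3) by (simp add: fibre_maps_def)
  finally show ?thesis .
qed

lemma card_not_in_fibres:
  assumes "finite V" "U \<subseteq> V" "f \<in> fibre_maps V U"
  shows "card {i \<in> V. f i \<notin> U} = card V - card U"
proof -
  have "{i \<in> V. f i \<notin> U} = V - {i \<in> V. f i \<in> U}" by auto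
  then show ?thesis
    using card_fibres [OF assms] assms(1) by (simp add: card_Diff_subset)
qed

lemma marginal_scale:
  assumes "finite V" "U \<subseteq> V"
  shows "marginal V b U (\<lambda>v. w * z v) = w ^ (card V - card U) * marginal V b U z"
  unfolding marginal_def sum_distrib_left
proof (rule sum.cong [OF refl])
  fix f assume f: "f \<in> fibre_maps V U"
  have "(\<Prod>i\<in>V. if f i \<in> U then 1 else w * z (f i))
      = (\<Prod>i\<in>V. if f i \<notin> U then w else 1) * (\<Prod>i\<in>V. if f i \<in> U then 1 else z (f i))"
    by (subst prod.distrib [symmetric]) (rule prod.cong, auto)
  also have "(\<Prod>i\<in>V. if f i \<notin> U then w else 1) = w ^ (card V - card U)"
    using assms(1) card_not_in_fibres [OF assms f] by (simp flip: prod.inter_filter)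
  finally show "of_real (\<Prod>i\<in>V. b i (f i)) * (\<Prod>i\<in>V. if f i \<in> U then 1 else w * z (f i))
    = w ^ (card V - card U) * (of_real (\<Prod>i\<in>V. b i (f i)) * (\<Prod>i\<in>V. if f i \<in> U then 1 else z (f i)))"
    by simp
qed

text \<open>The top power comes from the maps that send to \<open>v\<close> every argument not
  landing in \<open>U\<close>; their coefficients are positive and cannot cancel.\<close>

lemma degree_marginal_poly_pos:
  assumes "finite V" "U \<subseteq> V" "v \<in> V - U" and b: "\<And>i j. i \<in> V \<Longrightarrow> j \<in> V \<Longrightarrow> b i j > 0"
  shows "degree (marginal_poly V b U v z) > 0"
proof -
  let ?m = "card V - card U"
  have "card U < card V" using assms by (intro psubset_card_mono) auto
  let ?H = "{f \<in> fibre_maps V U. card {i \<in> V. f i \<notin> U \<and> f i = v} = ?m}"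
  have fin: "finite (fibre_maps V U)"
    using assms(1) by (simp add: fibre_maps_def finite_PiE)
  have one: "(\<Prod>i\<in>V. if f i \<in> U \<or> f i = v then 1 else z (f i)) = 1" if f: "f \<in> ?H" for f
  proof (rule prod.neutral, clarsimp)
    fix i assume i: "i \<in> V" "f i \<notin> U" "f i \<noteq> v"
    have "{i \<in> V. f i \<notin> U \<and> f i = v} = {i \<in> V. f i \<notin> U}"
      by (rule card_subset_eq) (use assms(1,2) f card_not_in_fibres [of V U f] in auto)
    then show "z (f i) = 1" using i by auto
  qed
  have "coeff (marginal_poly V b U v z) ?m = (\<Sum>f\<in>?H. of_real (\<Prod>i\<in>V. b i (f i)))"
    unfolding marginal_poly_def coeff_sum sum.inter_filter [OF fin]
    by (rule sum.cong) (use one in auto)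
  also have "\<dots> = of_real (\<Sum>f\<in>?H. \<Prod>i\<in>V. b i (f i))" by simp
  also have "\<dots> \<noteq> 0"
  proof -
    \<comment> \<open>Such a map exists: the identity on \<open>U\<close> and constantly
      \<open>v\<close> elsewhere.\<close>
    let ?f = "\<lambda>i\<in>V. if i \<in> U then i else v"
    have "{i \<in> V. ?f i = u} = {u}" if "u \<in> U" for u
      using that assms by (auto split: if_splits)
    moreover have "{i \<in> V. ?f i \<notin> U \<and> ?f i = v} = V - U"
      using assms by (auto split: if_splits)
    ultimately have f: "?f \<in> ?H"
      using assms card_Diff_subset [of U V] finite_subset [of U V] by (auto simp: fibre_maps_def)
    have "(\<Sum>f\<in>?H. \<Prod>i\<in>V. b i (f i)) > 0"
    proof (rule sum_pos)
      show "?H \<noteq> {}" using f by (metis empty_iff)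
      show "(\<Prod>i\<in>V. b i (f i)) > 0" if "f \<in> ?H" for f
        using that by (intro prod_pos b) (auto simp: fibre_maps_def)
    qed (simp add: fin)
    then have "(\<Sum>f\<in>?H. \<Prod>i\<in>V. b i (f i)) \<noteq> 0" by (rule less_imp_neq [symmetric])
    then show ?thesis by (simp only: of_real_eq_0_iff not_False_eq_True)
  qed
  finally have "?m \<le> degree (marginal_poly V b U v z)" by (rule le_degree)
  then show ?thesis using \<open>card U < card V\<close> by simp
qed

section \<open>Stability and capacity of the marginals\<close>

lemma marginal_empty:
  assumes "finite V"
  shows "marginal V b {} z = (\<Prod>i\<in>V. \<Sum>j\<in>V. of_real (b i j) * z j)"
  using prod_sum_PiE [of V "\<lambda>_. V" "\<lambda>i j. of_real (b i j) * z j"] assms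
  by (simp add: marginal_def fibre_maps_def prod.distrib)

text \<open>For empty \<open>U\<close> each linear form has positive real part. Adding
  \<open>v\<close> takes a linear coefficient, and the polynomial has no root in the closed right
  half-plane by induction, because a vertex outside \<open>insert v U\<close> keeps a positive real
  part whatever value \<open>v\<close> receives.\<close>

lemma marginal_stable:
  assumes "finite V" "U \<subseteq> V" and b: "\<And>i j. i \<in> V \<Longrightarrow> j \<in> V \<Longrightarrow> b i j > 0"
    and "\<And>v. v \<in> V - U \<Longrightarrow> Re (z v) \<ge> 0" "\<exists>v\<in>V - U. Re (z v) > 0"
  shows "marginal V b U z \<noteq> 0"
proof -
  have "finite U" using assms(1,2) finite_subset by auto
  then show ?thesis using assms(2,4,5)
  proof (induction U arbitrary: z)
    case empty
    then obtain v where v: "v \<in> V" "Re (z v) > 0" by auto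
    have "Re (\<Sum>j\<in>V. of_real (b i j) * z j) > 0" if "i \<in> V" for i
    proof -
      have "(\<Sum>j\<in>V. b i j * Re (z j)) > 0"
        using v that empty assms(1) less_imp_le [OF b] b
        by (intro sum_pos2 [OF assms(1) v(1)]) auto
      then show ?thesis by simp
    qed
    then have "(\<Sum>j\<in>V. of_real (b i j) * z j) \<noteq> 0" if "i \<in> V" for i
      using that by (metis less_irrefl zero_complex.sel(1))
    then show ?case
      using assms(1) by (simp add: marginal_empty)
  next
    case (insert v U)
    let ?g = "marginal_poly V b U v z"
    have "poly ?g t \<noteq> 0" if "Re t \<ge> 0" for t
      unfolding poly_marginal_poly [OF assms(1)]
    proof (rule insert.IH)
      show "\<exists>u\<in>V - U. Re ((z(v := t)) u) > 0" using insert.prems(3) by auto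
    qed (use insert that in auto)
    moreover have "degree ?g > 0"
      using insert by (intro degree_marginal_poly_pos assms(1) b) auto
    ultimately have "coeff ?g 1 \<noteq> 0" by (intro coeff_1_stable_neq_0)
    then show ?case using coeff_1_marginal_poly [OF assms(1) insert.hyps(2)] by simp
  qed
qed

definition real_marginal :: "'a set \<Rightarrow> ('a \<Rightarrow> 'a \<Rightarrow> real) \<Rightarrow> 'a set \<Rightarrow> ('a \<Rightarrow> real) \<Rightarrow> real" where
  "real_marginal V b U x =
    (\<Sum>f\<in>fibre_maps V U. (\<Prod>i\<in>V. b i (f i)) * (\<Prod>i\<in>V. if f i \<in> U then 1 else x (f i)))"

lemma marginal_of_real: "marginal V b U (\<lambda>v. of_real (x v)) = of_real (real_marginal V b U x)"
  by (simp add: marginal_def real_marginal_def if_distrib [of of_real] cong: if_cong)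

text \<open>By homogeneity a root \<open>t\<close> may be rotated, together with \<open>x\<close>, into the region of stability
  unless it is a negative real.\<close>

lemma marginal_poly_roots:
  assumes "finite V" "U \<subseteq> V" "v \<in> V - U" and b: "\<And>i j. i \<in> V \<Longrightarrow> j \<in> V \<Longrightarrow> b i j > 0"
    and x: "\<And>u. u \<in> V \<Longrightarrow> x u > 0" and ne: "V - insert v U \<noteq> {}"
    and root: "poly (marginal_poly V b U v (\<lambda>u. of_real (x u))) t = 0"
  shows "Im t = 0 \<and> Re t < 0"
proof (rule ccontr)
  assume neg: "\<not> (Im t = 0 \<and> Re t < 0)"
  let ?z = "(\<lambda>u. complex_of_real (x u))(v := t)"
  obtain u where u: "u \<in> V - insert v U" using ne by auto
  have "marginal V b U ?z = 0"
    using root by (simp only: poly_marginal_poly [OF assms(1)])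
  then have zero: "marginal V b U (\<lambda>u. w * ?z u) = 0" for w
    by (simp only: marginal_scale [OF assms(1,2)] mult_zero_right)
  have "\<exists>w. Re w > 0 \<and> Re (w * t) \<ge> 0"
  proof (cases "t = 0")
    case True
    then show ?thesis by (intro exI [of _ 1]) simp
  next
    case False
    \<comment> \<open>Multiplication by \<open>cnj s\<close> takes 1 to \<open>cnj s\<close> and
      \<open>t\<close> to a positive multiple of \<open>s\<close>. Both have positive real part,
      since a nonzero \<open>t\<close> with purely imaginary principal root is a negative
      real.\<close>
    define s where "s = csqrt t"
    have t: "t = s * s" by (simp add: s_def flip: power2_eq_square)
    have "Re s \<ge> 0" unfolding s_def by (rule Re_csqrt)
    moreover have "Re s \<noteq> 0"
    proof
      assume "Re s = 0"
      then have "Re t = - (Im s)\<^sup>2" "Im t = 0" by (simp_all add: t power2_eq_square)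
      moreover have "Im s \<noteq> 0" using False \<open>Re s = 0\<close> t by (auto simp: complex_eq_iff)
      ultimately show False using neg by simp
    qed
    moreover have "Re (cnj s * t) = ((Re s)\<^sup>2 + (Im s)\<^sup>2) * Re s"
      by (simp add: t power2_eq_square algebra_simps)
    ultimately show ?thesis by (intro exI [of _ "cnj s"]) simp
  qed
  then obtain w where w: "Re w > 0" "Re (w * t) \<ge> 0" by blast
  have "marginal V b U (\<lambda>u. w * ?z u) \<noteq> 0"
  proof (rule marginal_stable [OF assms(1,2) b])
    show "Re (w * ?z u) \<ge> 0" if "u \<in> V - U" for u
      using w x [of u] that by (auto simp: less_imp_le)
    show "\<exists>u\<in>V - U. Re (w * ?z u) > 0"
      using w x u by (intro bexI [of _ u]) auto
  qed
  then show False using zero by simp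
qed

text \<open>For empty \<open>U\<close> this is weighted AM-GM in each row, the column sums
  collecting every exponent to 1. Each vertex joining \<open>U\<close> then costs a factor
  e.\<close>

lemma real_marginal_capacity:
  assumes fin: "finite V" and "U \<subseteq> V" and b: "\<And>i j. i \<in> V \<Longrightarrow> j \<in> V \<Longrightarrow> b i j > 0"
    and rows: "\<And>i. i \<in> V \<Longrightarrow> (\<Sum>j\<in>V. b i j) = 1" and cols: "\<And>j. j \<in> V \<Longrightarrow> (\<Sum>i\<in>V. b i j) = 1"
    and "\<And>v. v \<in> V \<Longrightarrow> x v > 0"
  shows "(\<Prod>v\<in>V - U. x v) \<le> exp 1 ^ card U * real_marginal V b U x"
proof -
  have "finite U" using assms(1,2) finite_subset by auto
  then show ?thesis using assms(2,6)
  proof (induction U arbitrary: x)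
    case empty
    have "(\<Prod>v\<in>V. x v) = exp (\<Sum>j\<in>V. ln (x j))"
      using empty fin by (simp add: exp_sum)
    also have "(\<Sum>j\<in>V. ln (x j)) = (\<Sum>j\<in>V. (\<Sum>i\<in>V. b i j) * ln (x j))"
      using cols by simp
    also have "\<dots> = (\<Sum>i\<in>V. \<Sum>j\<in>V. b i j * ln (x j))"
      by (subst sum.swap) (simp add: sum_distrib_right)
    also have "exp \<dots> = (\<Prod>i\<in>V. exp (\<Sum>j\<in>V. b i j * ln (x j)))"
      using fin by (simp add: exp_sum)
    also have "\<dots> \<le> (\<Prod>i\<in>V. \<Sum>j\<in>V. b i j * x j)"
      using fin rows empty less_imp_le [OF b] by (intro prod_mono conjI weighted_am_gm) auto
    also have "\<dots> = real_marginal V b {} x"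
      using prod_sum_PiE [of V "\<lambda>_. V" "\<lambda>i j. b i j * x j"] fin
      by (simp add: real_marginal_def fibre_maps_def prod.distrib)
    finally show ?case by simp
  next
    case (insert v U)
    let ?z = "\<lambda>u. complex_of_real (x u)"
    let ?g = "marginal_poly V b U v ?z"
    have v: "v \<in> V - U" and UV: "U \<subseteq> V" using insert by auto
    have g: "poly ?g (of_real t) = of_real (real_marginal V b U (x(v := t)))" for t
    proof -
      have "?z(v := of_real t) = (\<lambda>u. of_real ((x(v := t)) u))" by auto
      then show ?thesis by (simp only: poly_marginal_poly [OF fin] marginal_of_real)
    qed
    have coeff1: "coeff ?g 1 = of_real (real_marginal V b (insert v U) x)"
      using coeff_1_marginal_poly [OF fin insert.hyps(2)] by (simp add: marginal_of_real)
    \<comment> \<open>The induction hypothesis with \<open>t\<close> for the variable of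
      \<open>v\<close>; the product on its left is linear in \<open>t\<close>.\<close>
    have K: "(\<Prod>u\<in>V - insert v U. x u) / exp 1 ^ card U * t \<le> Re (poly ?g (of_real t))" if "t > 0" for t
    proof -
      have "V - U = insert v (V - insert v U)" using v by auto
      then have "(\<Prod>u\<in>V - U. (x(v := t)) u) = t * (\<Prod>u\<in>V - insert v U. (x(v := t)) u)"
        using fin by (metis prod.insert finite_Diff Diff_iff fun_upd_same insertI1)
      also have "(\<Prod>u\<in>V - insert v U. (x(v := t)) u) = (\<Prod>u\<in>V - insert v U. x u)"
        by (rule prod.cong) auto
      finally have "t * (\<Prod>u\<in>V - insert v U. x u) = (\<Prod>u\<in>V - U. (x(v := t)) u)" ..
      also have "(\<Prod>u\<in>V - U. (x(v := t)) u) \<le> exp 1 ^ card U * real_marginal V b U (x(v := t))"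
        by (rule insert.IH [OF UV]) (use insert.prems that in auto)
      finally show ?thesis
        by (simp add: g field_simps del: fun_upd_apply)
    qed
    have "(\<Prod>u\<in>V - insert v U. x u) / exp 1 ^ card U \<le> exp 1 * real_marginal V b (insert v U) x"
    proof (cases "V - insert v U = {}")
      case False
      have nz: "marginal V b U (?z(v := 0)) \<noteq> 0"
        by (rule marginal_stable [OF fin UV b]) (use insert.prems False in \<open>auto simp: less_imp_le\<close>)
      have "real_marginal V b U (x(v := 0)) \<ge> 0"
        unfolding real_marginal_def using insert.prems b
        by (intro sum_nonneg mult_nonneg_nonneg prod_nonneg ballI)
           (auto simp: fibre_maps_def less_imp_le PiE_iff)
      moreover have "real_marginal V b U (x(v := 0)) \<noteq> 0"
        using nz g [of 0] by (auto simp: poly_marginal_poly [OF fin])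
      ultimately have pos: "real_marginal V b U (x(v := 0)) > 0" by simp
      show ?thesis
      proof (rule coeff_1_capacity [where g = ?g and ?g0.0 = "real_marginal V b U (x(v := 0))"])
        show "degree ?g > 0" by (rule degree_marginal_poly_pos [OF fin UV v b])
        show "coeff ?g 0 = of_real (real_marginal V b U (x(v := 0)))"
          using g [of 0] by (simp add: poly_0_coeff_0)
        show "Im t = 0 \<and> Re t < 0" if "poly ?g t = 0" for t
          by (rule marginal_poly_roots [OF fin UV v b _ False that]) (use insert.prems in auto)
      qed (use pos coeff1 K in auto)
    next
      \<comment> \<open>Here \<open>v\<close> is the last variable. The polynomial has constant term
        0, so \<open>coeff_1_capacity\<close> does not apply, but its linear coefficient is its
        value at 1.\<close>
      case True
      then have V: "V = insert v U" using insert.prems by auto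
      have "fibre_maps V V = fibre_maps V U"
      proof -
        have "card {i \<in> V. f i = v} = 1" if f: "f \<in> fibre_maps V U" for f
        proof -
          have "{i \<in> V. f i = v} = {i \<in> V. f i \<notin> U}"
            using f V insert.hyps(2) by (auto simp: fibre_maps_def)
          then show ?thesis
            using card_not_in_fibres [OF fin UV f] V insert.hyps by simp
        qed
        then show ?thesis using V by (auto simp: fibre_maps_def)
      qed
      then have "real_marginal V b (insert v U) x = real_marginal V b U (x(v := 1))"
        unfolding real_marginal_def V [symmetric]
        by (intro sum.cong arg_cong2 [where f = "(*)"] prod.cong)
           (use V in \<open>auto simp: fibre_maps_def PiE_iff\<close>)
      then have "1 / exp 1 ^ card U \<le> real_marginal V b (insert v U) x"
        using K [of 1] g [of 1] True by simp
      moreover have "(1::real) \<le> exp 1" by simp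
      ultimately show ?thesis
        using True by (smt (verit, best) mult_le_cancel_right1 divide_pos_pos zero_less_power exp_gt_zero prod.empty)
    qed
    then show ?case
      using insert.hyps by (simp add: field_simps)
  qed
qed

text \<open>After division by \<open>d\<close> the matrix is doubly stochastic, and its permanent is
  the marginal for \<open>U = V\<close>, in which no variable is left.\<close>

theorem permanent_ge:
  fixes B :: "'a \<Rightarrow> 'a \<Rightarrow> real"
  assumes fin: "finite V" "V \<noteq> {}" and B: "\<And>i j. i \<in> V \<Longrightarrow> j \<in> V \<Longrightarrow> B i j \<ge> 0" and d: "d > 0"
    and rows: "\<And>i. i \<in> V \<Longrightarrow> (\<Sum>j\<in>V. B i j) = d" and cols: "\<And>j. j \<in> V \<Longrightarrow> (\<Sum>i\<in>V. B i j) = d"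
  shows "(d / exp 1) ^ card V \<le> (\<Sum>p | p permutes V. \<Prod>i\<in>V. B i (p i))"
proof -
  let ?n = "card V"
  \<comment> \<open>Mixing with the constant matrix keeps all row and column sums 1 and makes the
    entries positive, as the capacity bound requires; finally \<open>\<epsilon>\<close> tends to
    0.\<close>
  define b where "b \<epsilon> i j = (1 - \<epsilon>) * (B i j / d) + \<epsilon> / ?n" for \<epsilon> :: real and i j
  have n: "?n > 0" using fin by (simp add: card_gt_0_iff)
  have perm: "(\<Sum>p | p permutes V. \<Prod>i\<in>V. c i (p i)) = (\<Sum>f\<in>fibre_maps V V. \<Prod>i\<in>V. c i (f i))"
    for c :: "'a \<Rightarrow> 'a \<Rightarrow> real"
  proof (rule sum.reindex_bij_witness
      [where i = "\<lambda>f v. if v \<in> V then f v else v" and j = "\<lambda>p. restrict p V"])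
    fix p assume "p \<in> {p. p permutes V}"
    then have p: "p permutes V" by simp
    show "(\<lambda>v. if v \<in> V then restrict p V v else v) = p"
      using p by (auto simp: permutes_not_in)
    have "{i \<in> V. restrict p V i = u} = {inv_into UNIV p u}" if "u \<in> V" for u
      using p that permutes_inverses [OF p] permutes_in_image [OF permutes_inv [OF p]] by auto
    then show "restrict p V \<in> fibre_maps V V"
      using p by (auto simp: fibre_maps_def permutes_in_image)
    show "(\<Prod>i\<in>V. c i (restrict p V i)) = (\<Prod>i\<in>V. c i (p i))" by simp
  next
    fix f assume f: "f \<in> fibre_maps V V"
    then show "restrict (\<lambda>v. if v \<in> V then f v else v) V = f"
      by (auto simp: fibre_maps_def PiE_iff extensional_def)
    have "inj_on f V"
    proof (rule inj_onI)
      fix u w assume uw: "u \<in> V" "w \<in> V" "f u = f w"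
      then have "card {i \<in> V. f i = f u} = 1" using f by (auto simp: fibre_maps_def)
      then obtain a where "{i \<in> V. f i = f u} = {a}" by (auto simp: card_1_singleton_iff)
      then show "u = w" using uw by (metis (mono_tags, lifting) mem_Collect_eq singletonD)
    qed
    then have "inj_on (\<lambda>v. if v \<in> V then f v else v) V"
      by (simp add: inj_on_def)
    then show "(\<lambda>v. if v \<in> V then f v else v) \<in> {p. p permutes V}"
      using f fin(1) by (auto simp: fibre_maps_def intro!: inj_imp_permutes)
  qed
  have bound: "(1 / exp 1) ^ ?n \<le> (\<Sum>p | p permutes V. \<Prod>i\<in>V. b \<epsilon> i (p i))" if \<epsilon>: "0 < \<epsilon>" "\<epsilon> < 1" for \<epsilon>
  proof -
    have pos: "b \<epsilon> i j > 0" if "i \<in> V" "j \<in> V" for i j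
      using B [OF that] d n \<epsilon> by (auto simp: b_def intro!: add_nonneg_pos)
    have "(\<Sum>j\<in>V. b \<epsilon> i j) = 1" if "i \<in> V" for i
      using rows [OF that] n d
      by (simp add: b_def sum.distrib flip: sum_distrib_left sum_divide_distrib)
    moreover have "(\<Sum>i\<in>V. b \<epsilon> i j) = 1" if "j \<in> V" for j
      using cols [OF that] n d
      by (simp add: b_def sum.distrib flip: sum_distrib_left sum_divide_distrib)
    ultimately have "1 \<le> exp 1 ^ ?n * real_marginal V (b \<epsilon>) V (\<lambda>_. 1)"
      using real_marginal_capacity [of V V "b \<epsilon>" "\<lambda>_. 1"] fin pos by simp
    moreover have "real_marginal V (b \<epsilon>) V (\<lambda>_. 1) = (\<Sum>p | p permutes V. \<Prod>i\<in>V. b \<epsilon> i (p i))"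
      by (simp add: real_marginal_def perm)
    ultimately show ?thesis by (simp add: field_simps)
  qed
  have "((\<lambda>\<epsilon>. \<Sum>p | p permutes V. \<Prod>i\<in>V. b \<epsilon> i (p i)) \<longlongrightarrow>
      (\<Sum>p | p permutes V. \<Prod>i\<in>V. (1 - 0) * (B i (p i) / d) + 0 / ?n)) (at_right 0)"
    unfolding b_def by (intro tendsto_intros) (use n in auto)
  then have "(1 / exp 1) ^ ?n \<le> (\<Sum>p | p permutes V. \<Prod>i\<in>V. (1 - 0) * (B i (p i) / d) + 0 / ?n)"
  proof (rule tendsto_lowerbound)
    show "\<forall>\<^sub>F \<epsilon> in at_right 0. (1 / exp 1) ^ ?n \<le> (\<Sum>p | p permutes V. \<Prod>i\<in>V. b \<epsilon> i (p i))"
      using bound by (auto simp: eventually_at_right_field intro!: exI [of _ 1])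
  qed simp
  also have "\<dots> = (\<Sum>p | p permutes V. \<Prod>i\<in>V. B i (p i)) / d ^ ?n"
    by (simp add: prod_dividef sum_divide_distrib)
  finally show ?thesis
    using d by (simp add: field_simps)
qed

section \<open>Signs of permutations and invariant colourings\<close>

lemma sign_cycle_of_list:
  "distinct cs \<Longrightarrow> cs \<noteq> [] \<Longrightarrow> sign (cycle_of_list cs) = (- 1) ^ (length cs - 1)"
proof (induction cs rule: cycle_of_list.induct)
  case (1 i j cs)
  have "sign (cycle_of_list (i # j # cs)) = sign (Transposition.transpose i j) * sign (cycle_of_list (j # cs))"
    unfolding cycle_of_list.simps
    by (intro sign_compose permutation_of_cycle permutation_swap_id)
  with 1 show ?case
    by (simp add: sign_swap_id del: cycle_of_list.simps)
qed auto

section \<open>Power sums of roots of unity\<close>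

definition nontrivial_roots :: "nat \<Rightarrow> complex set" where
  "nontrivial_roots r = {z. z ^ r = 1} - {1}"

lemma finite_nontrivial_roots: "r > 0 \<Longrightarrow> finite (nontrivial_roots r)"
  by (simp add: nontrivial_roots_def finite_roots_unity)

lemma card_nontrivial_roots: "r > 0 \<Longrightarrow> card (nontrivial_roots r) = r - 1"
  by (simp add: nontrivial_roots_def finite_roots_unity card_roots_unity_eq)

lemma norm_one_if_power_one:
  fixes z :: complex
  assumes "z ^ r = 1" "r > 0"
  shows "norm z = 1"
proof -
  have "norm z ^ r = 1 ^ r"
    using assms by (simp flip: norm_power)
  then show ?thesis
    by (rule power_eq_imp_eq_base) (use assms(2) in auto)
qed

lemma norm_nontrivial_roots: "r > 0 \<Longrightarrow> z \<in> nontrivial_roots r \<Longrightarrow> norm z = 1"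
  by (auto simp: nontrivial_roots_def intro: norm_one_if_power_one)

text \<open>Multiplication by \<open>\<zeta>\<close> permutes all \<open>r\<close>-th roots of unity
  and multiplies their power sum by \<open>\<zeta> ^ l \<noteq> 1\<close>. The full sum is therefore
  0, and leaving out the root 1 gives -1.\<close>

lemma sum_power_nontrivial_roots:
  assumes "r > 0" "\<not> r dvd l"
  shows "(\<Sum>z\<in>nontrivial_roots r. z ^ l) = -1"
proof -
  let ?R = "{z::complex. z ^ r = 1}"
  define \<zeta> where "\<zeta> = exp (2 * of_real pi * \<i> * of_nat 1 / of_nat r)"
  have \<zeta>: "\<zeta> ^ r = 1"
    unfolding \<zeta>_def by (rule complex_root_unity) (use assms in auto)
  have "\<zeta> ^ l = exp (2 * of_real pi * \<i> * of_nat l / of_nat r)"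
    unfolding \<zeta>_def exp_of_nat_mult [symmetric] by (simp add: mult_ac)
  then have \<zeta>l: "\<zeta> ^ l \<noteq> 1"
    using complex_root_unity_eq_1 [of r l] assms by (simp add: Suc_leI)
  have "\<zeta> \<noteq> 0" by (simp add: \<zeta>_def)
  have bij: "bij_betw ((*) \<zeta>) ?R ?R"
    by (rule bij_betw_byWitness [where f' = "(*) (inverse \<zeta>)"])
       (use \<zeta> \<open>\<zeta> \<noteq> 0\<close> assms in \<open>auto simp: power_mult_distrib power_inverse\<close>)
  have "(\<Sum>z\<in>?R. z ^ l) = (\<Sum>z\<in>?R. (\<zeta> * z) ^ l)"
    using sum.reindex_bij_betw [OF bij, of "\<lambda>z. z ^ l"] by simp
  also have "\<dots> = \<zeta> ^ l * (\<Sum>z\<in>?R. z ^ l)"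
    by (simp add: power_mult_distrib sum_distrib_left)
  finally have "(\<Sum>z\<in>?R. z ^ l) = 0"
    using \<zeta>l by (simp add: algebra_simps)
  then show ?thesis
    using assms by (simp add: nontrivial_roots_def finite_roots_unity sum_diff1)
qed

text \<open>Each cycle contributes the factor \<open>\<Sum> z ^ l = -1\<close>, where \<open>l\<close> is its length.\<close>

lemma sum_invariant_colourings:
  assumes "r > 0" "cycle_decomp T p" "finite T"
    and "\<And>cs. \<lbrakk>distinct cs; cs \<noteq> []; set cs \<subseteq> T; \<And>x. x \<in> set cs \<Longrightarrow> p x = cycle_of_list cs x\<rbrakk>
      \<Longrightarrow> \<not> r dvd length cs"
  shows "(\<Sum>c\<in>{c \<in> T \<rightarrow>\<^sub>E nontrivial_roots r. \<forall>v\<in>T. c (p v) = c v}. \<Prod>v\<in>T. c v)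
    = (-1) ^ card T * of_int (sign p)"
  using assms(2-4)
proof (induction rule: cycle_decomp.induct)
  case empty
  then show ?case by (simp add: PiE_empty_domain)
next
  case (comp I p cs)
  let ?Z = "nontrivial_roots r"
  let ?q = "cycle_of_list cs \<circ> p"
  have permI: "p permutes I"
    using comp.hyps(1) comp.prems(1)
  proof (induction rule: cycle_decomp.induct)
    case (comp I p cs)
    then have "p permutes (set cs \<union> I)"
      by (auto intro: permutes_subset)
    then show ?case
      by (intro permutes_compose permutes_subset[OF cycle_permutes]) auto
  qed simp
  have fin: "finite I" using comp.prems(1) by simp
  have q_cs: "?q v = cycle_of_list cs v" if "v \<in> set cs" for v
    using that permI comp.hyps(3) by (metis comp_apply disjoint_iff permutes_not_in)
  have q_I: "?q v = p v" if "v \<in> I" for v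
    using that permI comp.hyps(3)
    by (metis comp_apply disjoint_iff id_outside_supp permutes_in_image)
  have IH: "(\<Sum>c\<in>{c \<in> I \<rightarrow>\<^sub>E ?Z. \<forall>v\<in>I. c (p v) = c v}. \<Prod>v\<in>I. c v)
      = (-1) ^ card I * of_int (sign p)"
  proof (rule comp.IH [OF fin])
    fix ds
    assume ds: "distinct ds" "ds \<noteq> []" "set ds \<subseteq> I"
      "\<And>x. x \<in> set ds \<Longrightarrow> p x = cycle_of_list ds x"
    show "\<not> r dvd length ds"
      by (rule comp.prems(2)[OF ds(1,2)]) (use ds q_I in \<open>auto simp: subset_iff simp del: comp_apply\<close>)
  qed
  show ?case
  proof (cases "cs = []")
    case True
    then show ?thesis using IH by simp
  next
    case False
    then obtain u where u: "u \<in> set cs" by (meson last_in_set)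
    have len: "\<not> r dvd length cs"
      by (rule comp.prems(2)[OF comp.hyps(2) False]) (use q_cs in auto)
    \<comment> \<open>An invariant colouring amounts to one colour for the cycle \<open>cs\<close>
      and an invariant colouring of \<open>I\<close>.\<close>
    let ?glue = "\<lambda>(z, c) v. if v \<in> set cs then z else c v"
    let ?A = "{c \<in> (set cs \<union> I) \<rightarrow>\<^sub>E ?Z. \<forall>v\<in>set cs \<union> I. c (?q v) = c v}"
    let ?B = "?Z \<times> {c \<in> I \<rightarrow>\<^sub>E ?Z. \<forall>v\<in>I. c (p v) = c v}"
    have const: "c v = c u" if c: "c \<in> ?A" and v: "v \<in> set cs" for c v
    proof -
      have rot: "(cycle_of_list cs ^^ n) u \<in> set cs \<and> c ((cycle_of_list cs ^^ n) u) = c u" for n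
      proof (induction n)
        case (Suc n)
        let ?w = "(cycle_of_list cs ^^ n) u"
        have "c (?q ?w) = c ?w" using c Suc by blast
        then show ?case
          using Suc q_cs [of ?w] permutes_in_image [OF cycle_permutes, of cs ?w] by simp
      qed (use u in simp)
      obtain i j where ij: "i < length cs" "j < length cs" "u = cs ! i" "v = cs ! j"
        using u v by (metis in_set_conv_nth)
      \<comment> \<open>So many steps lead from position \<open>i\<close> to position
        \<open>j\<close> cyclically; adding the length keeps the subtraction from
        truncating.\<close>
      have "map (cycle_of_list cs ^^ (j + length cs - i)) cs = rotate (j + length cs - i) cs"
        by (rule cyclic_rotation [OF comp.hyps(2)])
      then have "(cycle_of_list cs ^^ (j + length cs - i)) u = rotate (j + length cs - i) cs ! i"
        using ij by (metis nth_map)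
      also have "\<dots> = v"
        using ij by (simp add: nth_rotate)
      finally show ?thesis using rot by metis
    qed
    have "(\<Sum>c\<in>?A. \<Prod>v\<in>set cs \<union> I. c v) = (\<Sum>(z, c)\<in>?B. z ^ length cs * (\<Prod>v\<in>I. c v))"
    proof (rule sum.reindex_bij_witness [where i = ?glue and j = "\<lambda>c. (c u, restrict c I)"])
      fix c assume c: "c \<in> ?A"
      then have cE: "c \<in> extensional (set cs \<union> I)" by (auto simp: PiE_def)
      show "?glue (c u, restrict c I) = c"
      proof
        fix v
        show "?glue (c u, restrict c I) v = c v"
          using const [OF c, of v] cE by (simp add: extensional_def)
      qed
      have "c (p v) = c v" if "v \<in> I" for v
      proof -
        have "c (?q v) = c v" using c that by blast
        then show ?thesis by (simp only: q_I[OF that])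
      qed
      moreover have "c v \<in> ?Z" if "v \<in> set cs \<union> I" for v
        using c that by blast
      ultimately show "(c u, restrict c I) \<in> ?B"
        using u permutes_in_image[OF permI] by (simp add: PiE_iff)
      have "(\<Prod>v\<in>set cs \<union> I. c v) = (\<Prod>v\<in>set cs. c v) * (\<Prod>v\<in>I. c v)"
        using comp.hyps(3) fin by (intro prod.union_disjoint) auto
      also have "(\<Prod>v\<in>set cs. c v) = (\<Prod>v\<in>set cs. c u)"
        by (rule prod.cong [OF refl const[OF c]])
      also have "\<dots> = c u ^ length cs"
        using comp.hyps(2) by (simp add: distinct_card)
      also have "(\<Prod>v\<in>I. c v) = (\<Prod>v\<in>I. restrict c I v)" by simp
      finally show "(case (c u, restrict c I) of (z, c) \<Rightarrow> z ^ length cs * (\<Prod>v\<in>I. c v)) = (\<Prod>v\<in>set cs \<union> I. c v)"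
        by (simp only: prod.case)
    next
      fix zc assume zc: "zc \<in> ?B"
      obtain z c where [simp]: "zc = (z, c)" by fastforce
      have z: "z \<in> ?Z" and c: "c \<in> I \<rightarrow>\<^sub>E ?Z" "\<forall>v\<in>I. c (p v) = c v" using zc by auto
      have disj: "v \<in> I \<Longrightarrow> v \<notin> set cs" for v using comp.hyps(3) by auto
      show "(?glue zc u, restrict (?glue zc) I) = zc"
        using u c(1) disj by (auto simp: fun_eq_iff PiE_iff extensional_def restrict_def)
      have "?glue zc (?q v) = ?glue zc v" if v: "v \<in> set cs \<union> I" for v
      proof (cases "v \<in> set cs")
        case True
        then show ?thesis
          using q_cs[OF True] permutes_in_image [OF cycle_permutes, of cs v] by simp
      next
        case False
        then show ?thesis
          using q_I[of v] v c(2) permutes_in_image [OF permI, of v] disj[of "p v"]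
          by (simp del: comp_apply)
      qed
      moreover have "?glue zc \<in> (set cs \<union> I) \<rightarrow>\<^sub>E ?Z"
        using z c(1) by (auto simp: PiE_iff extensional_def)
      ultimately show "?glue zc \<in> ?A" by blast
    qed
    also have "\<dots> = (\<Sum>z\<in>?Z. z ^ length cs) * (\<Sum>c\<in>{c \<in> I \<rightarrow>\<^sub>E ?Z. \<forall>v\<in>I. c (p v) = c v}. \<Prod>v\<in>I. c v)"
      by (simp add: sum_product sum.cartesian_product)
    also have "\<dots> = - ((-1) ^ card I * of_int (sign p))"
      using IH sum_power_nontrivial_roots[OF assms(1) len] by simp
    \<comment> \<open>The new cycle contributes its length to the cardinality and one less than its
      length to the exponent of the sign, together a factor -1.\<close>
    also have "\<dots> = (-1) ^ card (set cs \<union> I) * of_int (sign ?q)"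
    proof -
      have "sign ?q = (-1) ^ (length cs - 1) * sign p"
        using sign_compose [OF permutation_of_cycle permutes_imp_permutation [OF fin permI]]
          sign_cycle_of_list [OF comp.hyps(2) False] by simp
      moreover have "card (set cs \<union> I) = length cs + card I"
        using comp.hyps(2,3) fin by (simp add: card_Un_disjoint distinct_card)
      moreover have "(-1::complex) ^ length cs * (-1) ^ (length cs - 1) = -1"
        using False by (cases cs) (simp_all flip: power_mult_distrib)
      ultimately show ?thesis
        by (simp add: power_add algebra_simps)
    qed
    finally show ?thesis .
  qed
qed

section \<open>Hadamard's inequality\<close>

text \<open>Moves Leibniz' expansion to an initial segment of the naturals, where matrices are
  indexed; conjugation by a bijection preserves signs.\<close>

lemma sum_permutes_reindex:
  assumes h: "bij_betw h A B" and "finite A"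
  shows "(\<Sum>p | p permutes B. of_int (sign p) * (\<Prod>v\<in>B. M v (p v)))
    = (\<Sum>p | p permutes A. of_int (sign p) * (\<Prod>i\<in>A. M (h i) (h (p i))) :: 'a :: comm_ring_1)"
proof (rule sum.reindex_bij_witness
    [where j = "map_permutation B (inv_into A h)" and i = "map_permutation A h"])
  have inj: "inj_on h A" and B: "B = h ` A" and inv: "bij_betw (inv_into A h) B A"
    using h bij_betw_inv_into [OF h] by (auto simp: bij_betw_def)
  have fin: "finite B" using assms(2) B by simp
  {
    fix p assume "p \<in> {p. p permutes B}"
    then have p: "p permutes B" by simp
    let ?q = "map_permutation B (inv_into A h) p"
    have q: "?q permutes A" using p inv by (simp add: map_permutation_permutes)
    then show "?q \<in> {p. p permutes A}" by simp
    show "map_permutation A h ?q = p"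
      by (rule map_permutation_compose_inv) (use p inv h in \<open>auto simp: B f_inv_into_f\<close>)
    have sgn: "sign ?q = sign p"
      by (rule sign_map_permutation) (use p fin inv in \<open>auto simp: bij_betw_def\<close>)
    have app: "h (?q i) = p (h i)" if "i \<in> A" for i
    proof -
      have "?q (inv_into A h (h i)) = inv_into A h (p (h i))"
        by (rule map_permutation_apply) (use that inv B in \<open>auto simp: bij_betw_def\<close>)
      moreover have "p (h i) \<in> h ` A"
        using p that B by (simp add: permutes_in_image)
      ultimately show ?thesis
        using that inj by (simp add: f_inv_into_f)
    qed
    have "(\<Prod>i\<in>A. M (h i) (h (?q i))) = (\<Prod>i\<in>A. M (h i) (p (h i)))"
      by (rule prod.cong) (simp_all add: app)
    also have "\<dots> = (\<Prod>v\<in>B. M v (p v))"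
      using prod.reindex [OF inj, of "\<lambda>v. M v (p v)"] B by simp
    finally show "of_int (sign ?q) * (\<Prod>i\<in>A. M (h i) (h (?q i)))
        = of_int (sign p) * (\<Prod>v\<in>B. M v (p v))"
      by (simp add: sgn)
  next
    fix p assume "p \<in> {p. p permutes A}"
    then have p: "p permutes A" by simp
    show "map_permutation A h p \<in> {p. p permutes B}"
      using map_permutation_permutes [OF h p] by simp
    show "map_permutation B (inv_into A h) (map_permutation A h p) = p"
      by (rule map_permutation_compose_inv) (use p h inj in auto)
  }
qed

text \<open>Pivoting on the last vector makes it orthogonal to the others, which can only shrink.\<close>

lemma gram_det_le:
  fixes x :: "nat \<Rightarrow> nat \<Rightarrow> real" and w :: nat
  defines "gram \<equiv> \<lambda>(n::nat) (x :: nat \<Rightarrow> nat \<Rightarrow> real). mat n n (\<lambda>(i, j). \<Sum>k<w. x i k * x j k)"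
  shows "0 \<le> det (gram n x) \<and> det (gram n x) \<le> (\<Prod>i<n. \<Sum>k<w. (x i k)\<^sup>2)"
proof (induction n arbitrary: x)
  case 0
  then show ?case by (simp add: gram_def)
next
  case (Suc m)
  let ?ip = "\<lambda>y z :: nat \<Rightarrow> real. \<Sum>k<w. y k * z k"
  define u where "u = x m"
  \<comment> \<open>If \<open>u\<close> vanishes, division by zero yields \<open>a i = 0\<close>,
    and the orthogonality below holds trivially.\<close>
  define a where "a i = ?ip (x i) u / ?ip u u" for i
  define y where "y i k = x i k - a i * u k" for i k
  have ip_y: "?ip (y i) z = ?ip (x i) z - a i * ?ip u z" for i z
    by (simp add: y_def algebra_simps sum_subtractf sum_distrib_left)
  have orth: "?ip (y i) u = 0" for i
  proof (cases "?ip u u = 0")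
    case True
    then have "\<forall>k<w. u k = 0"
      by (auto simp: sum_nonneg_eq_0_iff)
    then show ?thesis by simp
  next
    case False
    then show ?thesis by (simp add: ip_y a_def)
  qed
  have ip_yy: "?ip (y i) (y j) = ?ip (y i) (x j)" for i j
  proof -
    have "?ip (y i) (y j) = ?ip (y i) (x j) - a j * ?ip (y i) u"
      by (simp add: y_def [of j] algebra_simps sum_subtractf sum_distrib_left)
    then show ?thesis by (simp add: orth)
  qed
  have y_le: "?ip (y i) (y i) \<le> ?ip (x i) (x i)" for i
  proof -
    have "?ip (x i) (x i) = (\<Sum>k<w. (y i k + a i * u k) * (y i k + a i * u k))"
      by (simp add: y_def)
    also have "\<dots> = ?ip (y i) (y i) + 2 * a i * ?ip (y i) u + (a i)\<^sup>2 * ?ip u u"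
      by (simp add: algebra_simps sum.distrib sum_distrib_left power2_eq_square)
    also have "\<dots> \<ge> ?ip (y i) (y i)"
      by (simp add: orth sum_nonneg)
    finally show ?thesis .
  qed
  \<comment> \<open>Multiplication by \<open>L\<close> subtracts \<open>a i\<close> times the last
    row from each earlier row and leaves the determinant unchanged.\<close>
  define L where "L = mat (Suc m) (Suc m)
    (\<lambda>(i, j). if i = j then 1 else if j = m then - a i else 0 :: real)"
  have "det L = prod_list (diag_mat L)"
    by (rule det_upper_triangular [of L "Suc m"]) (auto simp: L_def)
  also have "\<dots> = 1"
    by (simp add: L_def prod_list_diag_prod)
  finally have detL: "det L = 1" .
  \<comment> \<open>By orthogonality the last column vanishes above its corner, and
    \<open>ip_yy\<close> identifies the upper left block as the Gram matrix of the
    \<open>y i\<close>.\<close>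
  let ?F = "four_block_mat (gram m y) (0\<^sub>m m 1) (mat 1 m (\<lambda>(i, j). ?ip u (x j))) (mat 1 1 (\<lambda>_. ?ip u u))"
  have "L * gram (Suc m) x = ?F"
  proof (rule eq_matI)
    fix i j assume "i < dim_row ?F" "j < dim_col ?F"
    then have ij: "i < Suc m" "j < Suc m" by (simp_all add: gram_def)
    have "(L * gram (Suc m) x) $$ (i, j) = (\<Sum>l<Suc m. L $$ (i, l) * ?ip (x l) (x j))"
      using ij by (simp add: L_def gram_def scalar_prod_def atLeast0LessThan)
    also have "\<dots> = (if i < m then ?ip (y i) (x j) else ?ip u (x j))"
    proof (cases "i < m")
      case True
      have "(\<Sum>l<Suc m. L $$ (i, l) * ?ip (x l) (x j))
          = (\<Sum>l<m. L $$ (i, l) * ?ip (x l) (x j)) - a i * ?ip u (x j)"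
        using True by (simp add: L_def u_def)
      also have "(\<Sum>l<m. L $$ (i, l) * ?ip (x l) (x j)) = (\<Sum>l<m. if l = i then ?ip (x i) (x j) else 0)"
        using True by (intro sum.cong) (auto simp: L_def)
      finally show ?thesis using True by (simp add: ip_y)
    next
      case False
      then have "i = m" using ij by simp
      then show ?thesis by (simp add: L_def u_def)
    qed
    also have "\<dots> = ?F $$ (i, j)"
      using ij orth by (auto simp: gram_def ip_yy less_Suc_eq u_def)
    finally show "(L * gram (Suc m) x) $$ (i, j) = ?F $$ (i, j)" .
  qed (simp_all add: L_def gram_def)
  then have "det L * det (gram (Suc m) x) = det ?F"
    using det_mult [of L "Suc m" "gram (Suc m) x"] by (simp add: L_def gram_def)
  also have "det ?F = det (gram m y) * ?ip u u"
    using det_four_block_mat_upper_right_zero_col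
      [of "gram m y" m "0\<^sub>m m 1" "mat 1 m (\<lambda>(i, j). ?ip u (x j))" "mat 1 1 (\<lambda>_. ?ip u u)"]
      det_single [of "mat 1 1 (\<lambda>_. ?ip u u)"]
    by (simp add: gram_def del: One_nat_def)
  finally have eq: "det (gram (Suc m) x) = det (gram m y) * ?ip u u"
    by (simp add: detL)
  have "det (gram m y) \<le> (\<Prod>i<m. \<Sum>k<w. (x i k)\<^sup>2)"
  proof (rule order_trans)
    show "det (gram m y) \<le> (\<Prod>i<m. \<Sum>k<w. (y i k)\<^sup>2)" using Suc.IH [of y] by simp
    show "(\<Prod>i<m. \<Sum>k<w. (y i k)\<^sup>2) \<le> (\<Prod>i<m. \<Sum>k<w. (x i k)\<^sup>2)"
      using y_le by (intro prod_mono) (simp add: power2_eq_square sum_nonneg)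
  qed
  then have "det (gram m y) * ?ip u u \<le> (\<Prod>i<m. \<Sum>k<w. (x i k)\<^sup>2) * ?ip u u"
    by (rule mult_right_mono) (simp add: sum_nonneg)
  moreover have "0 \<le> det (gram m y) * ?ip u u"
    using Suc.IH [of y] by (intro mult_nonneg_nonneg) (simp_all add: sum_nonneg)
  moreover have "?ip u u = (\<Sum>k<w. (x m k)\<^sup>2)"
    by (simp add: u_def power2_eq_square)
  ultimately show ?case
    by (simp only: eq prod.lessThan_Suc)
qed

text \<open>The Gram matrix of the rows is \<open>A * A\<^sup>T\<close>, whose determinant is the
  square of that of \<open>A\<close>.\<close>

theorem hadamard_inequality:
  fixes M :: "'a \<Rightarrow> 'a \<Rightarrow> real"
  assumes "finite T"
  shows "\<bar>\<Sum>p | p permutes T. of_int (sign p) * (\<Prod>v\<in>T. M v (p v))\<bar>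
    \<le> (\<Prod>v\<in>T. sqrt (\<Sum>w\<in>T. (M v w)\<^sup>2))"
proof -
  obtain h where h: "bij_betw h {..<card T} T"
    using ex_bij_betw_nat_finite [OF assms] by (auto simp: atLeast0LessThan)
  let ?n = "card T"
  define A where "A = mat ?n ?n (\<lambda>(i, j). M (h i) (h j))"
  have A: "A \<in> carrier_mat ?n ?n" by (simp add: A_def)
  have "(\<Sum>p | p permutes T. of_int (sign p) * (\<Prod>v\<in>T. M v (p v)))
     = (\<Sum>p | p permutes {..<?n}. of_int (sign p) * (\<Prod>i<?n. M (h i) (h (p i))))"
    by (rule sum_permutes_reindex [OF h]) simp
  also have "\<dots> = det A"
    unfolding det_def' [OF A] atLeast0LessThan
  proof (intro sum.cong refl arg_cong2 [where f = "(*)"] prod.cong)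
    fix p i assume "p \<in> {p. p permutes {..<?n}}" "i \<in> {..<?n}"
    then show "M (h i) (h (p i)) = A $$ (i, p i)"
      using permutes_in_image [of p "{..<?n}" i] by (simp add: A_def)
  qed
  finally have eq: "(\<Sum>p | p permutes T. of_int (sign p) * (\<Prod>v\<in>T. M v (p v))) = det A" .
  have "(det A)\<^sup>2 = det (A * A\<^sup>T)"
    using det_mult [OF A, of "A\<^sup>T"] det_transpose [OF A] A by (simp add: power2_eq_square)
  also have "A * A\<^sup>T = mat ?n ?n (\<lambda>(i, j). \<Sum>k<?n. M (h i) (h k) * M (h j) (h k))"
    by (rule eq_matI) (simp_all add: A_def scalar_prod_def atLeast0LessThan)
  also have "det \<dots> \<le> (\<Prod>i<?n. \<Sum>k<?n. (M (h i) (h k))\<^sup>2)"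
    using gram_det_le [where n = ?n and w = ?n and x = "\<lambda>i k. M (h i) (h k)"] by simp
  also have "\<dots> = (\<Prod>i<?n. \<Sum>w\<in>T. (M (h i) w)\<^sup>2)"
    by (intro prod.cong refl sum.reindex_bij_betw [OF h])
  also have "\<dots> = (\<Prod>v\<in>T. \<Sum>w\<in>T. (M v w)\<^sup>2)"
    by (rule prod.reindex_bij_betw [OF h])
  also have "\<dots> = (\<Prod>v\<in>T. sqrt (\<Sum>w\<in>T. (M v w)\<^sup>2))\<^sup>2"
    by (simp add: prod_power_distrib sum_nonneg)
  finally have "\<bar>det A\<bar> \<le> \<bar>\<Prod>v\<in>T. sqrt (\<Sum>w\<in>T. (M v w)\<^sup>2)\<bar>"
    by (rule real_sqrt_le_mono [of "_\<^sup>2" "_\<^sup>2", unfolded real_sqrt_abs])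
  then show ?thesis
    by (simp add: eq prod_nonneg sum_nonneg)
qed

section \<open>Functional digraphs weighted by cycles\<close>

text \<open>
  The number of colourings of \<open>V\<close> that are constant along the arcs of the partial function
  \<open>f\<close> on \<open>T\<close> is \<open>q\<close> to the number of components, i.e. to \<open>card (V - T)\<close> plus the number of
  cycles of \<open>f\<close>.
\<close>

definition compatible :: "'a set \<Rightarrow> 'c set \<Rightarrow> 'a set \<Rightarrow> ('a \<Rightarrow> 'a) \<Rightarrow> ('a \<Rightarrow> 'c) set" where
  "compatible V Q T f = {c \<in> V \<rightarrow>\<^sub>E Q. \<forall>v\<in>T. c (f v) = c v}"

definition steps :: "'a set \<Rightarrow> ('a \<Rightarrow> 'a) \<Rightarrow> ('a \<times> 'a) set" where
  "steps T f = {(v, f v) | v. v \<in> T}"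

lemma steps_mono: "S \<subseteq> T \<Longrightarrow> (steps S f)\<^sup>* \<subseteq> (steps T f)\<^sup>*"
  by (rule rtrancl_mono) (auto simp: steps_def)

lemma steps_from:
  assumes "(x, y) \<in> (steps T f)\<^sup>*" "x \<noteq> y"
  shows "x \<in> T" "(f x, y) \<in> (steps T f)\<^sup>*"
  using assms by (auto simp: steps_def elim!: converse_rtranclE)

lemma steps_to: "x \<in> T \<Longrightarrow> (f x, y) \<in> (steps T f)\<^sup>* \<Longrightarrow> (x, y) \<in> (steps T f)\<^sup>*"
  by (rule converse_rtrancl_into_rtrancl [of _ "f x"]) (auto simp: steps_def)

lemma steps_cong: "(\<And>v. v \<in> T \<Longrightarrow> f v = g v) \<Longrightarrow> steps T f = steps T g"
  by (auto simp: steps_def)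

text \<open>Were \<open>w\<close> on a cycle, everything reachable from it would lead back to it;
  but \<open>v\<close> is reachable and has no arc out of it.\<close>

lemma steps_restrict_avoid:
  assumes "w \<in> T" "v \<notin> T" "(w, v) \<in> (steps T f)\<^sup>*"
  shows "(f w, v) \<in> (steps (T - {w}) f)\<^sup>*" "(f w, w) \<notin> (steps (T - {w}) f)\<^sup>*"
proof -
  have "w \<noteq> v" using assms by auto
  have no_return: "(f w, w) \<notin> (steps T f)\<^sup>*"
  proof
    assume return: "(f w, w) \<in> (steps T f)\<^sup>*"
    have "(x, w) \<in> (steps T f)\<^sup>*" if "(w, x) \<in> (steps T f)\<^sup>*" for x
      using that
    proof (induction rule: rtrancl_induct)
      case (step y z)
      then have z: "z = f y" by (auto simp: steps_def)
      show ?case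
      proof (cases "y = w")
        case True
        then show ?thesis using return z by simp
      next
        case False
        then show ?thesis using steps_from(2) [OF step.IH] z by simp
      qed
    qed simp
    then have "(v, w) \<in> (steps T f)\<^sup>*" using assms(3) .
    then show False using steps_from(1) \<open>w \<noteq> v\<close> assms(2) by metis
  qed
  then show no: "(f w, w) \<notin> (steps (T - {w}) f)\<^sup>*"
    using steps_mono [of "T - {w}" T f] by auto
  \<comment> \<open>A path to \<open>v\<close> avoids the arc out of \<open>w\<close>, or its part
    up to the first visit of \<open>w\<close> does.\<close>
  have "(x, v) \<in> (steps (T - {w}) f)\<^sup>* \<or> (x, w) \<in> (steps (T - {w}) f)\<^sup>*"
    if "(x, v) \<in> (steps T f)\<^sup>*" for x
    using that
  proof (induction rule: converse_rtrancl_induct)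
    case (step x z)
    then show ?case
      by (cases "x = w") (auto simp: steps_def intro: converse_rtrancl_into_rtrancl)
  qed simp
  then show "(f w, v) \<in> (steps (T - {w}) f)\<^sup>*"
    using steps_from(2) [OF assms(3) \<open>w \<noteq> v\<close>] no by blast
qed

lemma finite_compatible: "finite V \<Longrightarrow> finite Q \<Longrightarrow> finite (compatible V Q T f)"
  by (simp add: compatible_def finite_PiE)

text \<open>If \<open>v\<close> lies on no cycle, the vertices leading to \<open>v\<close> can be recoloured freely once
  the arc out of \<open>v\<close> is dropped.\<close>

lemma card_compatible_acyclic:
  assumes fin: "finite V" "finite Q" and T: "T \<subseteq> V" and f: "f \<in> T \<rightarrow> V" and v: "v \<in> T"
    and acyc: "(f v, v) \<notin> (steps (T - {v}) f)\<^sup>*"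
  shows "card Q * card (compatible V Q T f) \<le> card (compatible V Q (T - {v}) f)"
proof -
  \<comment> \<open>The vertices leading to \<open>v\<close> without use of its own arc; by
    \<open>acyc\<close>, \<open>f v\<close> is not among them.\<close>
  define A where "A = {u. (u, v) \<in> (steps (T - {v}) f)\<^sup>*}"
  have vA: "v \<in> A" and fvA: "f v \<notin> A" using acyc by (auto simp: A_def)
  have AT: "A \<subseteq> T"
    using steps_from(1) v by (fastforce simp: A_def)
  have step: "f u \<in> A \<longleftrightarrow> u \<in> A" if "u \<in> T - {v}" for u
    using that steps_from(2) [of u v "T - {v}" f] steps_to [of u "T - {v}" f v]
    by (auto simp: A_def)
  \<comment> \<open>Recolouring \<open>A\<close> loses no information: its old colour is that of
    \<open>v\<close>, hence that of \<open>f v\<close>, which is kept.\<close>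
  let ?g = "\<lambda>(x, c) u. if u \<in> A then x else c u"
  have const: "c u = c v" if c: "c \<in> compatible V Q T f" and u: "u \<in> A" for c u
    using u unfolding A_def mem_Collect_eq
  proof (induction rule: converse_rtrancl_induct)
    case (step y z)
    then have "c (f y) = c y" using c by (auto simp: compatible_def steps_def)
    then show ?case using step by (auto simp: steps_def)
  qed simp
  have "card (Q \<times> compatible V Q T f) \<le> card (compatible V Q (T - {v}) f)"
  proof (rule card_inj_on_le [where f = ?g])
    show "inj_on ?g (Q \<times> compatible V Q T f)"
    proof (rule inj_onI, clarify)
      fix x c y d
      assume c: "c \<in> compatible V Q T f" and d: "d \<in> compatible V Q T f"
        and eq: "(\<lambda>u. if u \<in> A then x else c u) = (\<lambda>u. if u \<in> A then y else d u)"
      have "c u = d u" if "u \<notin> A" for u using fun_cong [OF eq, of u] that by simp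
      moreover from this have "c v = d v"
        using c d v fvA by (fastforce simp: compatible_def)
      moreover have "x = y" using fun_cong [OF eq, of v] vA by simp
      ultimately show "x = y \<and> c = d"
        using const [OF c] const [OF d] by (metis ext)
    qed
    show "?g ` (Q \<times> compatible V Q T f) \<subseteq> compatible V Q (T - {v}) f"
    proof clarify
      fix x c assume x: "x \<in> Q" and c: "c \<in> compatible V Q T f"
      show "(\<lambda>u. if u \<in> A then x else c u) \<in> compatible V Q (T - {v}) f"
        using x c AT T step by (auto simp: compatible_def PiE_iff extensional_def)
    qed
  qed (simp add: fin finite_compatible)
  then show ?thesis by (simp add: card_cartesian_product)
qed

section \<open>Counting maps by deleting one arc at a time\<close>

definition weight :: "'a set \<Rightarrow> 'c set \<Rightarrow> ('a \<Rightarrow> 'a set) \<Rightarrow> 'a set \<Rightarrow> nat" where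
  "weight V Q N T = (\<Sum>f\<in>PiE T N. card (compatible V Q T f))"

text \<open>For \<open>v \<notin> T\<close> this singles out the maps in which a new arc from
  \<open>v\<close> to \<open>w\<close> would close a cycle.\<close>

definition reach_weight ::
  "'a set \<Rightarrow> 'c set \<Rightarrow> ('a \<Rightarrow> 'a set) \<Rightarrow> 'a set \<Rightarrow> 'a \<Rightarrow> 'a \<Rightarrow> nat" where
  "reach_weight V Q N T v w =
    (\<Sum>f\<in>PiE T N. if (w, v) \<in> (steps T f)\<^sup>* then card (compatible V Q T f) else 0)"

lemma sum_PiE_remove:
  assumes "v \<in> T"
  shows "(\<Sum>f\<in>PiE T N. g f) = (\<Sum>x\<in>N v. \<Sum>f\<in>PiE (T - {v}) N. g (f(v := x)))"
proof -
  have "(\<Sum>f\<in>PiE T N. g f)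
      = (\<Sum>f\<in>(\<lambda>(x, f). f(v := x)) ` (N v \<times> PiE (T - {v}) N). g f)"
    using PiE_insert_eq [of v "T - {v}" N] assms by (simp add: insert_absorb)
  also have "\<dots> = (\<Sum>(x, f)\<in>N v \<times> PiE (T - {v}) N. g (f(v := x)))"
    by (subst sum.reindex) (auto intro!: inj_combinator simp: case_prod_beta o_def)
  finally show ?thesis by (simp add: sum.cartesian_product)
qed

lemma compatible_fun_upd:
  "compatible V Q (T - {v}) (f(v := x)) = compatible V Q (T - {v}) f"
  by (auto simp: compatible_def)

lemma steps_fun_upd: "steps (T - {v}) (f(v := x)) = steps (T - {v}) f"
  by (rule steps_cong) auto

context
  fixes V :: "'a set" and Q :: "'c set" and N :: "'a \<Rightarrow> 'a set" and d :: nat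
  assumes finV: "finite V" and finQ: "finite Q" and NV: "\<And>v. v \<in> V \<Longrightarrow> N v \<subseteq> V"
    and loopless: "\<And>v. v \<notin> N v" and degree: "\<And>v. v \<in> V \<Longrightarrow> card (N v) \<le> d"
    and Q_le: "0 < card Q" "card Q \<le> d"
begin

lemma fun_upd_in_Pi:
  assumes "T \<subseteq> V" "v \<in> T" "x \<in> N v" "f \<in> PiE (T - {v}) N"
  shows "f(v := x) \<in> T \<rightarrow> V"
  using assms NV by (fastforce simp: PiE_iff)

text \<open>Either \<open>v\<close> lies on no cycle, or the path from its image leads back to \<open>v\<close>; the latter maps
  are counted by following that path and deleting its vertices one at a time.\<close>

lemma weight_step:
  assumes T: "T \<subseteq> V" and v: "v \<in> T"
  shows "card Q * weight V Q N T
    \<le> (\<Sum>x\<in>N v. weight V Q N (T - {v}) + card Q * reach_weight V Q N (T - {v}) v x)"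
  unfolding weight_def reach_weight_def sum_PiE_remove [OF v] sum_distrib_left sum.distrib [symmetric]
proof (intro sum_mono)
  fix x f assume x: "x \<in> N v" and f: "f \<in> PiE (T - {v}) N"
  let ?f = "f(v := x)"
  have "compatible V Q T ?f \<subseteq> compatible V Q (T - {v}) f"
    by (auto simp: compatible_def)
  then have "card (compatible V Q T ?f) \<le> card (compatible V Q (T - {v}) f)"
    by (rule card_mono [OF finite_compatible [OF finV finQ]])
  moreover have "card Q * card (compatible V Q T ?f) \<le> card (compatible V Q (T - {v}) f)"
    if "(x, v) \<notin> (steps (T - {v}) f)\<^sup>*"
    using card_compatible_acyclic [OF finV finQ T fun_upd_in_Pi [OF T v x f] v] that
    by (simp add: compatible_fun_upd steps_fun_upd)
  ultimately show "card Q * card (compatible V Q T ?f) \<le> card (compatible V Q (T - {v}) f)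
      + card Q * (if (x, v) \<in> (steps (T - {v}) f)\<^sup>* then card (compatible V Q (T - {v}) f) else 0)"
    by (auto intro: trans_le_add2)
qed

text \<open>A vertex leading out of \<open>T\<close> lies on no cycle, so dropping its arc gains the
  factor \<open>card Q\<close>, and the path continues from its image.\<close>

lemma reach_weight_step:
  assumes T: "T \<subseteq> V" and w: "w \<in> T" and v: "v \<notin> T"
  shows "card Q * reach_weight V Q N T v w \<le> (\<Sum>x\<in>N w. reach_weight V Q N (T - {w}) v x)"
  unfolding reach_weight_def sum_PiE_remove [OF w] sum_distrib_left
proof (intro sum_mono)
  fix x f assume x: "x \<in> N w" and f: "f \<in> PiE (T - {w}) N"
  let ?f = "f(w := x)"
  have "(x, v) \<in> (steps (T - {w}) f)\<^sup>* \<and>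
      card Q * card (compatible V Q T ?f) \<le> card (compatible V Q (T - {w}) f)"
    if "(w, v) \<in> (steps T ?f)\<^sup>*"
    using steps_restrict_avoid [OF w v that]
      card_compatible_acyclic [OF finV finQ T fun_upd_in_Pi [OF T w x f] w]
    by (simp add: compatible_fun_upd steps_fun_upd)
  then show "card Q * (if (w, v) \<in> (steps T ?f)\<^sup>* then card (compatible V Q T ?f) else 0)
      \<le> (if (x, v) \<in> (steps (T - {w}) f)\<^sup>* then card (compatible V Q (T - {w}) f) else 0)"
    by auto
qed

lemma reach_weight_self: "reach_weight V Q N T v v = weight V Q N T"
  by (simp add: reach_weight_def weight_def)

lemma reach_weight_outside: "w \<notin> T \<Longrightarrow> w \<noteq> v \<Longrightarrow> reach_weight V Q N T v w = 0"
proof -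
  assume "w \<notin> T" "w \<noteq> v"
  then have "(w, v) \<notin> (steps T f)\<^sup>*" for f
    using steps_from(1) [of w v T f] by blast
  then show ?thesis by (simp add: reach_weight_def)
qed

text \<open>The two bounds are proved together. If \<open>B\<close> bounds both left sides after
  deletion of a vertex, the step lemmas give at most \<open>d * B + card Q * B\<close> and
  \<open>d * B + d * B\<close>, both at most \<open>2 * d * B\<close>. The factor \<open>d\<close>
  before \<open>reach_weight\<close> avoids a division.\<close>

lemma weight_bounds:
  assumes "T \<subseteq> V"
  shows "weight V Q N T \<le> (2 * d) ^ card T * card Q ^ card (V - T)
    \<and> (\<forall>v w. v \<notin> T \<longrightarrow> w \<noteq> v \<longrightarrow> d * reach_weight V Q N T v w \<le> (2 * d) ^ card T * card Q ^ card (V - T))"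
  using assms
proof (induction "card T" arbitrary: T)
  case 0
  then have T: "T = {}" using finV finite_subset by fastforce
  have "weight V Q N T = card (V \<rightarrow>\<^sub>E Q)"
    by (simp add: T weight_def compatible_def)
  then have "weight V Q N T = card Q ^ card V"
    by (simp add: card_PiE [OF finV])
  then show ?case by (simp add: T reach_weight_outside)
next
  case (Suc n)
  have fin: "finite T" using Suc.prems finV finite_subset by auto
  \<comment> \<open>The claimed bound for \<open>T\<close> without one vertex: a factor
    \<open>2 * d\<close> is traded for a factor \<open>card Q\<close>.\<close>
  define B where "B = (2 * d) ^ n * card Q ^ Suc (card (V - T))"
  have goalB: "x \<le> (2 * d) ^ card T * card Q ^ card (V - T)" if "card Q * x \<le> 2 * d * B" for x
  proof -
    have "card Q * x \<le> card Q * ((2 * d) ^ card T * card Q ^ card (V - T))"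
      using that by (simp add: B_def mult_ac flip: Suc.hyps(2))
    then show ?thesis using Q_le by simp
  qed
  have IH: "weight V Q N (T - {v}) \<le> B"
    "\<And>u w. u \<notin> T - {v} \<Longrightarrow> w \<noteq> u \<Longrightarrow> d * reach_weight V Q N (T - {v}) u w \<le> B" if "v \<in> T" for v
  proof -
    have "V - (T - {v}) = insert v (V - T)" using that Suc.prems by auto
    then have "card (V - (T - {v})) = Suc (card (V - T))" using that finV by simp
    moreover have "n = card (T - {v})" using that Suc.hyps(2) by simp
    ultimately show "weight V Q N (T - {v}) \<le> B"
      "\<And>u w. u \<notin> T - {v} \<Longrightarrow> w \<noteq> u \<Longrightarrow> d * reach_weight V Q N (T - {v}) u w \<le> B"
      using Suc.hyps(1) [of "T - {v}"] Suc.prems by (auto simp: B_def)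
  qed
  have d: "d > 0" using Q_le by simp
  show ?case
  proof (intro conjI allI impI)
    have "T \<noteq> {}" using Suc.hyps(2) by auto
    then obtain v where v: "v \<in> T" by auto
    then have vV: "v \<in> V" using Suc.prems by auto
    show "weight V Q N T \<le> (2 * d) ^ card T * card Q ^ card (V - T)"
    proof (rule goalB)
      have "d * (card Q * weight V Q N T)
          \<le> d * (\<Sum>x\<in>N v. weight V Q N (T - {v}) + card Q * reach_weight V Q N (T - {v}) v x)"
        by (rule mult_le_mono2 [OF weight_step [OF Suc.prems v]])
      also have "\<dots> = (\<Sum>x\<in>N v. d * weight V Q N (T - {v})
          + card Q * (d * reach_weight V Q N (T - {v}) v x))"
        by (simp add: sum_distrib_left algebra_simps)
      \<comment> \<open>Looplessness gives \<open>x \<noteq> v\<close>, so the bound on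
        \<open>reach_weight\<close> is available.\<close>
      also have "\<dots> \<le> (\<Sum>x\<in>N v. d * B + card Q * B)"
        using IH [OF v] loopless [of v]
        by (intro sum_mono add_mono mult_le_mono2) (auto, metis)
      also have "\<dots> \<le> d * (d * B + d * B)"
        using degree [OF vV] Q_le by (simp add: mult_le_mono)
      finally show "card Q * weight V Q N T \<le> 2 * d * B" using d by simp
    qed
  next
    fix v w assume v: "v \<notin> T" and wv: "w \<noteq> v"
    show "d * reach_weight V Q N T v w \<le> (2 * d) ^ card T * card Q ^ card (V - T)"
    proof (cases "w \<in> T")
      case False
      then show ?thesis by (simp add: reach_weight_outside wv)
    next
      case True
      then have wV: "w \<in> V" using Suc.prems by auto
      have finN: "finite (N w)" using NV [OF wV] finV finite_subset by auto
      show ?thesis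
      proof (rule goalB)
        have "card Q * (d * reach_weight V Q N T v w) \<le> d * (\<Sum>x\<in>N w. reach_weight V Q N (T - {w}) v x)"
          using mult_le_mono2 [OF reach_weight_step [OF Suc.prems True v], of d] by (simp add: mult_ac)
        also have "\<dots> = (\<Sum>x\<in>N w. d * reach_weight V Q N (T - {w}) v x)"
          by (simp add: sum_distrib_left)
        \<comment> \<open>For \<open>x = v\<close> the path has arrived and the whole weight counts;
          this happens for at most one \<open>x\<close>.\<close>
        also have "\<dots> \<le> (\<Sum>x\<in>N w. B + (if x = v then d * B else 0))"
        proof (rule sum_mono)
          fix x
          show "d * reach_weight V Q N (T - {w}) v x \<le> B + (if x = v then d * B else 0)"
            using IH [OF True] v by (cases "x = v") (auto simp: reach_weight_self intro: trans_le_add2)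
        qed
        also have "\<dots> \<le> card (N w) * B + d * B"
          using finN by (simp add: sum.distrib)
        also have "\<dots> \<le> 2 * d * B"
          using degree [OF wV] by (simp add: mult_le_mono1)
        finally show "card Q * (d * reach_weight V Q N T v w) \<le> 2 * d * B" .
      qed
    qed
  qed
qed

text \<open>Double counting of pairs of a colouring and a map choosing for each vertex an
  out-neighbour of its colour; grouped by maps, the count is \<open>weight V Q N V\<close>.\<close>

lemma sum_prod_agreeing_le:
  "(\<Sum>c\<in>V \<rightarrow>\<^sub>E Q. \<Prod>v\<in>V. card {w \<in> N v. c w = c v}) \<le> (2 * d) ^ card V"
proof -
  have fin: "finite (N v)" if "v \<in> V" for v
    using NV [OF that] finV finite_subset by auto
  have "(\<Sum>c\<in>V \<rightarrow>\<^sub>E Q. \<Prod>v\<in>V. card {w \<in> N v. c w = c v})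
      = (\<Sum>c\<in>V \<rightarrow>\<^sub>E Q. card (PiE V (\<lambda>v. {w \<in> N v. c w = c v})))"
    by (simp add: card_PiE [OF finV])
  also have "\<dots> = (\<Sum>c\<in>V \<rightarrow>\<^sub>E Q. \<Sum>f\<in>PiE V N. if \<forall>v\<in>V. c (f v) = c v then 1 else 0)"
  proof (rule sum.cong [OF refl])
    fix c assume "c \<in> V \<rightarrow>\<^sub>E Q"
    have "PiE V (\<lambda>v. {w \<in> N v. c w = c v}) = {f \<in> PiE V N. \<forall>v\<in>V. c (f v) = c v}"
      by (auto simp: PiE_iff extensional_def)
    then show "card (PiE V (\<lambda>v. {w \<in> N v. c w = c v}))
        = (\<Sum>f\<in>PiE V N. if \<forall>v\<in>V. c (f v) = c v then 1 else 0)"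
      using fin by (simp add: finite_PiE finV flip: sum.inter_filter)
  qed
  also have "\<dots> = (\<Sum>f\<in>PiE V N. \<Sum>c\<in>V \<rightarrow>\<^sub>E Q. if \<forall>v\<in>V. c (f v) = c v then 1 else 0)"
    by (rule sum.swap)
  also have "\<dots> = weight V Q N V"
    by (simp add: weight_def compatible_def finite_PiE finV finQ flip: sum.inter_filter)
  also have "\<dots> \<le> (2 * d) ^ card V"
    using weight_bounds [of V] by simp
  finally show ?thesis .
qed

end

section \<open>Cycles of length divisible by r\<close>

lemma sum_le_sqrt_card:
  fixes a :: "'a \<Rightarrow> real"
  assumes "\<And>x. x \<in> A \<Longrightarrow> a x \<ge> 0"
  shows "(\<Sum>x\<in>A. sqrt (a x)) \<le> sqrt (card A * (\<Sum>x\<in>A. a x))"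
proof (rule real_le_rsqrt)
  have "(\<Sum>x\<in>A. sqrt (a x) * 1)\<^sup>2 \<le> (\<Sum>x\<in>A. (sqrt (a x))\<^sup>2) * (\<Sum>x\<in>A. 1\<^sup>2)"
    by (rule Cauchy_Schwarz_ineq_sum)
  then show "(\<Sum>x\<in>A. sqrt (a x))\<^sup>2 \<le> card A * (\<Sum>x\<in>A. a x)"
    using assms by (simp add: mult.commute)
qed

lemma sqrt_prod: "sqrt (\<Prod>x\<in>A. f x) = (\<Prod>x\<in>A. sqrt (f x))"
  by (induction A rule: infinite_finite_induct) (simp_all add: real_sqrt_mult)

text \<open>Colourings turn a permanent into a combination of determinants \<open>D c\<close> with
  coefficients of modulus 1. The hypothesis \<open>r - 1 \<le> d\<close> is what the weighted count
  asks of the number of colours.\<close>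

lemma card_cycle_covers_le:
  fixes N :: "'a \<Rightarrow> 'a set"
  assumes fin: "finite T" and N: "\<And>v. v \<in> T \<Longrightarrow> N v \<subseteq> T" "\<And>v. v \<notin> N v"
    and d: "\<And>v. v \<in> T \<Longrightarrow> card (N v) \<le> d" and r: "r \<ge> 2" "r - 1 \<le> d"
    and no_cycle: "\<And>cs. \<lbrakk>distinct cs; cs \<noteq> []; set cs \<subseteq> T; \<And>x. x \<in> set cs \<Longrightarrow> cycle_of_list cs x \<in> N x\<rbrakk>
      \<Longrightarrow> \<not> r dvd length cs"
  shows "card {p. p permutes T \<and> (\<forall>v\<in>T. p v \<in> N v)} \<le> sqrt (2 * real d * real (r - 1)) ^ card T"
proof -
  let ?Z = "nontrivial_roots r"
  let ?C = "T \<rightarrow>\<^sub>E ?Z"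
  define P where "P = {p. p permutes T \<and> (\<forall>v\<in>T. p v \<in> N v)}"
  define M :: "('a \<Rightarrow> complex) \<Rightarrow> 'a \<Rightarrow> 'a \<Rightarrow> real"
    where "M c v w = (if w \<in> N v \<and> c w = c v then 1 else 0)" for c v w
  define D where "D c = (\<Sum>p | p permutes T. of_int (sign p) * (\<Prod>v\<in>T. M c v (p v)))" for c
  have r0: "r > 0" using r by simp
  have finZ: "finite ?Z" "card ?Z = r - 1"
    using r0 by (simp_all add: finite_nontrivial_roots card_nontrivial_roots)
  have finC: "finite ?C" by (simp add: finite_PiE fin finZ)
  have finP: "finite {p. p permutes T}" using fin by (rule finite_permutations)
  have M_prod: "(\<Prod>v\<in>T. M c v (p v)) = (if p \<in> P \<and> (\<forall>v\<in>T. c (p v) = c v) then 1 else 0)"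
    if "p permutes T" for c p
    using that fin by (auto simp: M_def P_def)
  have colourings: "(\<Sum>c\<in>{c \<in> ?C. \<forall>v\<in>T. c (p v) = c v}. \<Prod>v\<in>T. c v)
      = (-1) ^ card T * of_int (sign p)" if p: "p \<in> P" for p
  proof (rule sum_invariant_colourings [OF r0 _ fin])
    show "cycle_decomp T p"
      using p fin by (intro cycle_decomposition) (auto simp: P_def)
    fix cs assume cs: "distinct cs" "cs \<noteq> []" "set cs \<subseteq> T"
      and p_cs: "\<And>x. x \<in> set cs \<Longrightarrow> p x = cycle_of_list cs x"
    have "cycle_of_list cs x \<in> N x" if "x \<in> set cs" for x
      using p cs(3) that p_cs [OF that, symmetric] by (auto simp: P_def)
    with cs show "\<not> r dvd length cs" by (rule no_cycle)
  qed
  have "of_nat (card P) = (\<Sum>p\<in>P. (1::complex))" by simp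
  \<comment> \<open>One copy of the signed unit becomes the sum over colourings; the other supplies
    the sign in the expansion of \<open>D c\<close>.\<close>
  also have "\<dots> = (\<Sum>p\<in>P. (-1) ^ card T * of_int (sign p) * ((-1) ^ card T * of_int (sign p)))"
  proof (rule sum.cong [OF refl])
    fix p
    have "(-1) ^ card T * complex_of_int (sign p) * ((-1) ^ card T * of_int (sign p))
        = ((-1) ^ card T * (-1) ^ card T) * of_int (sign p * sign p)"
      by (simp only: of_int_mult mult_ac)
    also have "\<dots> = 1"
      unfolding power_mult_distrib [symmetric] by (simp del: of_int_mult)
    finally show "1 = (-1) ^ card T * complex_of_int (sign p) * ((-1) ^ card T * of_int (sign p))" ..
  qed
  also have "\<dots> = (\<Sum>p\<in>P. (-1) ^ card T * of_int (sign p) *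
      (\<Sum>c\<in>?C. if \<forall>v\<in>T. c (p v) = c v then \<Prod>v\<in>T. c v else 0))"
    using colourings by (simp add: finC flip: sum.inter_filter)
  \<comment> \<open>Permutations outside \<open>P\<close> may be added because they use a zero entry
    of \<open>M c\<close>.\<close>
  also have "\<dots> = (\<Sum>p | p permutes T. \<Sum>c\<in>?C. (-1) ^ card T * of_int (sign p) *
      ((\<Prod>v\<in>T. c v) * of_real (\<Prod>v\<in>T. M c v (p v))))"
    unfolding sum_distrib_left
  proof (rule sum.mono_neutral_cong_left [OF finP])
    show "P \<subseteq> {p. p permutes T}" by (auto simp: P_def)
    show "\<forall>p\<in>{p. p permutes T} - P. (\<Sum>c\<in>?C. (-1) ^ card T * of_int (sign p) *
      ((\<Prod>v\<in>T. c v) * of_real (\<Prod>v\<in>T. M c v (p v)))) = 0"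
      by (simp add: M_prod)
  next
    fix p assume "p \<in> P"
    then have "p permutes T" by (simp add: P_def)
    then show "(\<Sum>c\<in>?C. (-1) ^ card T * of_int (sign p) * (if \<forall>v\<in>T. c (p v) = c v then \<Prod>v\<in>T. c v else 0))
      = (\<Sum>c\<in>?C. (-1) ^ card T * of_int (sign p) * ((\<Prod>v\<in>T. c v) * of_real (\<Prod>v\<in>T. M c v (p v))))"
      using \<open>p \<in> P\<close> by (intro sum.cong) (auto simp: M_prod)
  qed
  also have "\<dots> = (\<Sum>c\<in>?C. (-1) ^ card T * (\<Prod>v\<in>T. c v) * of_real (D c))"
    by (subst sum.swap) (simp add: D_def sum_distrib_left mult_ac)
  finally have eq: "of_nat (card P) = (\<Sum>c\<in>?C. (-1) ^ card T * (\<Prod>v\<in>T. c v) * of_real (D c))" .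
  have "real (card P) = norm (of_nat (card P) :: complex)" by simp
  also have "\<dots> \<le> (\<Sum>c\<in>?C. norm ((-1) ^ card T * (\<Prod>v\<in>T. c v) * of_real (D c)))"
    unfolding eq by (rule norm_sum)
  also have "\<dots> = (\<Sum>c\<in>?C. \<bar>D c\<bar>)"
  proof (rule sum.cong [OF refl])
    fix c assume c: "c \<in> ?C"
    have "norm (\<Prod>v\<in>T. c v) = 1"
      unfolding prod_norm [symmetric]
      by (rule prod.neutral) (use c norm_nontrivial_roots [OF r0] in auto)
    then show "norm ((-1) ^ card T * (\<Prod>v\<in>T. c v) * of_real (D c)) = \<bar>D c\<bar>"
      by (simp add: norm_mult norm_power)
  qed
  \<comment> \<open>Hadamard's inequality; the rows are 0/1 vectors, so a squared norm counts the
    out-neighbours of the same colour.\<close>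
  also have "\<dots> \<le> (\<Sum>c\<in>?C. sqrt (\<Prod>v\<in>T. card {w \<in> N v. c w = c v}))"
  proof (rule sum_mono)
    fix c
    have "(\<Sum>w\<in>T. (M c v w)\<^sup>2) = card {w \<in> N v. c w = c v}" if "v \<in> T" for v
    proof -
      have "(\<Sum>w\<in>T. (M c v w)\<^sup>2) = (\<Sum>w\<in>T. if w \<in> N v \<and> c w = c v then 1 else 0)"
        by (rule sum.cong) (auto simp: M_def)
      also have "\<dots> = card {w \<in> T. w \<in> N v \<and> c w = c v}"
        by (simp add: fin flip: sum.inter_filter)
      also have "{w \<in> T. w \<in> N v \<and> c w = c v} = {w \<in> N v. c w = c v}"
        using N(1) [OF that] by auto
      finally show ?thesis .
    qed
    then have "\<bar>D c\<bar> \<le> (\<Prod>v\<in>T. sqrt (card {w \<in> N v. c w = c v}))"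
      using hadamard_inequality [OF fin, of "M c"] by (simp add: D_def)
    then show "\<bar>D c\<bar> \<le> sqrt (\<Prod>v\<in>T. card {w \<in> N v. c w = c v})"
      by (simp add: sqrt_prod)
  qed
  \<comment> \<open>Cauchy-Schwarz over the colourings pulls the sum under the root, where
    \<open>sum_prod_agreeing_le\<close> applies.\<close>
  also have "\<dots> \<le> sqrt (card ?C * (\<Sum>c\<in>?C. \<Prod>v\<in>T. card {w \<in> N v. c w = c v}))"
    unfolding of_nat_mult of_nat_sum by (rule sum_le_sqrt_card) (simp add: prod_nonneg)
  also have "\<dots> \<le> sqrt ((r - 1) ^ card T * (2 * d) ^ card T)"
  proof (rule real_sqrt_le_mono)
    have "(\<Sum>c\<in>?C. \<Prod>v\<in>T. card {w \<in> N v. c w = c v}) \<le> (2 * d) ^ card T"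
      by (rule sum_prod_agreeing_le) (use fin finZ N d r in auto)
    then show "real (card ?C * (\<Sum>c\<in>?C. \<Prod>v\<in>T. card {w \<in> N v. c w = c v}))
        \<le> real ((r - 1) ^ card T * (2 * d) ^ card T)"
      by (simp only: of_nat_le_iff card_PiE [OF fin] finZ prod_constant) simp
  qed
  also have "\<dots> = sqrt (2 * real d * real (r - 1)) ^ card T"
    by (simp add: real_sqrt_power real_sqrt_mult power_mult_distrib mult_ac)
  finally show ?thesis by (simp add: P_def)
qed

text \<open>\<open>S\<close> collects the vertices at which the diagonal summand is chosen. Only
  permutations fixing \<open>S\<close> pointwise survive, and these permute
  \<open>V - S\<close>.\<close>

lemma prod_permutes_diag_plus:
  fixes m :: "'a \<Rightarrow> real" and A :: "'a \<Rightarrow> 'a \<Rightarrow> real"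
  assumes "finite V"
  shows "(\<Sum>p | p permutes V. \<Prod>v\<in>V. (if p v = v then m v else 0) + A v (p v))
    = (\<Sum>S\<in>Pow V. (\<Prod>v\<in>S. m v) * (\<Sum>p | p permutes (V - S). \<Prod>v\<in>V - S. A v (p v)))"
proof -
  have "(\<Sum>p | p permutes V. \<Prod>v\<in>V. (if p v = v then m v else 0) + A v (p v))
      = (\<Sum>S\<in>Pow V. \<Sum>p | p permutes V. (\<Prod>v\<in>S. if p v = v then m v else 0) * (\<Prod>v\<in>V - S. A v (p v)))"
    using assms by (simp add: prod_add sum.swap [of _ "Pow V"])
  also have "\<dots> = (\<Sum>S\<in>Pow V. \<Sum>p | p permutes (V - S). (\<Prod>v\<in>S. m v) * (\<Prod>v\<in>V - S. A v (p v)))"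
  proof (rule sum.cong [OF refl], rule sum.mono_neutral_cong_right)
    fix S assume S: "S \<in> Pow V"
    then have finS: "finite S" using assms finite_subset by auto
    show "finite {p. p permutes V}" using assms by (rule finite_permutations)
    show "{p. p permutes V - S} \<subseteq> {p. p permutes V}"
      by (auto intro: permutes_subset)
    show "\<forall>p\<in>{p. p permutes V} - {p. p permutes V - S}.
        (\<Prod>v\<in>S. if p v = v then m v else 0) * (\<Prod>v\<in>V - S. A v (p v)) = 0"
    proof
      fix p assume p: "p \<in> {p. p permutes V} - {p. p permutes V - S}"
      then obtain v where "v \<in> S" "p v \<noteq> v"
        using permutes_superset [of p V "V - S"] by auto
      then show "(\<Prod>v\<in>S. if p v = v then m v else 0) * (\<Prod>v\<in>V - S. A v (p v)) = 0"
        using finS by auto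
    qed
    fix p assume "p \<in> {p. p permutes V - S}"
    then have "p v = v" if "v \<in> S" for v using that permutes_not_in by fastforce
    then show "(\<Prod>v\<in>S. if p v = v then m v else 0) * (\<Prod>v\<in>V - S. A v (p v))
      = (\<Prod>v\<in>S. m v) * (\<Prod>v\<in>V - S. A v (p v))"
      by simp
  qed
  finally show ?thesis by (simp add: sum_distrib_left)
qed

section \<open>Numerical estimates and the comparison of the two bounds\<close>

lemma exp_1_ge: "exp (1::real) \<ge> 27 / 10"
proof -
  \<comment> \<open>The base is the quadratic Taylor polynomial of \<open>exp\<close> at
    \<open>1 / 8\<close>.\<close>
  have "(145 / 128 :: real) ^ 8 \<le> exp (1 / 8) ^ 8"
    using exp_lower_Taylor_quadratic [of "1 / 8"] by (intro power_mono) (simp_all add: power2_eq_square)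
  also have "\<dots> = exp 1" by (simp flip: exp_of_nat_mult)
  finally show ?thesis by (simp add: power_divide)
qed

text \<open>By squaring, \<open>(d / e - K)\<^sup>2 \<ge> 2 * d * K\<close> suffices. With
  \<open>d = e ^ 3 * K + \<delta>\<close> the terms in \<open>\<delta>\<close> are nonnegative, and
  an inequality in \<open>e\<close> alone remains.\<close>

lemma degree_inequality:
  fixes d K :: real
  assumes "K \<ge> 0" "d \<ge> exp 1 ^ 3 * K"
  shows "K + sqrt (2 * d * K) \<le> d / exp 1"
proof -
  define e where "e = exp (1::real)"
  have e: "27 / 10 \<le> e" "e \<le> 3" using exp_1_ge exp_le by (simp_all add: e_def)
  define \<delta> where "\<delta> = d - e ^ 3 * K"
  have \<delta>: "\<delta> \<ge> 0" "d = e ^ 3 * K + \<delta>" using assms by (simp_all add: \<delta>_def e_def)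
  have sq: "e\<^sup>2 \<ge> 27 / 10 * e" "e\<^sup>2 \<le> 9"
    using e mult_mono [of e 3 e 3] by (simp_all add: power2_eq_square)
  have "0 \<le> e\<^sup>2 * (e\<^sup>2 - 2 * e - 2) + 1"
  proof -
    \<comment> \<open>Since \<open>e\<close> is at least 2.7, the first two terms are at least 0.7
      times 2.7, that is 1.89. With \<open>e\<^sup>2 \<le> 9\<close> the deficit below is at most
      0.99, just less than 1.\<close>
    have "e\<^sup>2 - 2 * e - 2 \<ge> - (11 / 100)"
      using sq e by simp
    then have "e\<^sup>2 * (e\<^sup>2 - 2 * e - 2) \<ge> e\<^sup>2 * - (11 / 100)"
      by (rule mult_left_mono) simp
    then show ?thesis using sq by simp
  qed
  moreover have "d / e = e\<^sup>2 * K + \<delta> / e"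
    using e by (simp add: \<delta> field_simps power_numeral_reduce)
  ultimately have "(d / e - K)\<^sup>2 - 2 * d * K \<ge> 0"
  proof -
    have "(d / e - K)\<^sup>2 - 2 * d * K
        = K\<^sup>2 * (e\<^sup>2 * (e\<^sup>2 - 2 * e - 2) + 1) + (\<delta> / e)\<^sup>2 + 2 * K * (\<delta> / e) * (e\<^sup>2 - e - 1)"
      using e unfolding \<open>d / e = _\<close> by (simp add: \<delta> field_simps power2_eq_square power3_eq_cube)
    moreover have "e\<^sup>2 - e - 1 \<ge> 0" using sq e by simp
    ultimately show ?thesis
      using \<open>0 \<le> e\<^sup>2 * (e\<^sup>2 - 2 * e - 2) + 1\<close> \<delta> e assms(1) by simp
  qed
  moreover have "d / e - K \<ge> 0"
  proof -
    have "d / e - K = K * (e\<^sup>2 - 1) + \<delta> / e"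
      unfolding \<open>d / e = _\<close> by (simp add: algebra_simps)
    then show ?thesis using sq e \<delta> assms(1) by simp
  qed
  ultimately have "sqrt (2 * d * K) \<le> d / e - K"
    by (intro real_le_lsqrt) auto
  then show ?thesis by (simp add: e_def)
qed

text \<open>Here \<open>m v\<close> is the number of loops added at \<open>v\<close> to raise row
  and column sums to \<open>d\<close>. Without the desired cycle the two bounds on the permanent
  contradict each other.\<close>

lemma exists_cycle_dvd:
  fixes N :: "'a \<Rightarrow> 'a set" and m :: "'a \<Rightarrow> nat"
  assumes fin: "finite V" "V \<noteq> {}" and N: "\<And>v. v \<in> V \<Longrightarrow> N v \<subseteq> V" "\<And>v. v \<notin> N v"
    and outdeg: "\<And>v. v \<in> V \<Longrightarrow> card (N v) + m v = d"
    and indeg: "\<And>v. v \<in> V \<Longrightarrow> card {u \<in> V. v \<in> N u} + m v = d"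
    and m: "\<And>v. v \<in> V \<Longrightarrow> m v < K" and r: "2 \<le> r" "r - 1 \<le> K"
    and d: "real d \<ge> exp 1 ^ 3 * real K"
  obtains cs where "distinct cs" "cs \<noteq> []" "set cs \<subseteq> V" "r dvd length cs"
    "\<And>x. x \<in> set cs \<Longrightarrow> cycle_of_list cs x \<in> N x"
proof (rule ccontr)
  note found = that
  assume not: "\<not> thesis"
  have no_cycle: "\<not> r dvd length cs" if "distinct cs" "cs \<noteq> []" "set cs \<subseteq> V"
    "\<And>x. x \<in> set cs \<Longrightarrow> cycle_of_list cs x \<in> N x" for cs
    using not found that by blast
  have n: "card V > 0" using fin by (simp add: card_gt_0_iff)
  have K: "K > 0" using m fin(2) by fastforce
  have "real K \<le> exp 1 ^ 3 * real K"
    using K by (simp add: one_le_power)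
  then have Kd: "K \<le> d" using d by linarith
  define s where "s = sqrt (2 * real d * real (r - 1))"
  have "s \<ge> 0" by (simp add: s_def)
  define A :: "'a \<Rightarrow> 'a \<Rightarrow> real" where "A v w = (if w \<in> N v then 1 else 0)" for v w
  let ?B = "\<lambda>v w. (if w = v then real (m v) else 0) + A v w"
  have "(d / exp 1) ^ card V \<le> (\<Sum>p | p permutes V. \<Prod>v\<in>V. ?B v (p v))"
  proof (rule permanent_ge [OF fin])
    fix v assume v: "v \<in> V"
    have "(\<Sum>w\<in>V. A v w) = card {w \<in> V. w \<in> N v}"
      using fin by (simp add: A_def flip: sum.inter_filter)
    also have "{w \<in> V. w \<in> N v} = N v" using N v by auto
    finally show "(\<Sum>w\<in>V. ?B v w) = d"
      using outdeg [OF v] v fin by (simp add: sum.distrib)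
    have "(\<Sum>u\<in>V. A u v) = card {u \<in> V. v \<in> N u}"
      using fin by (simp add: A_def flip: sum.inter_filter)
    moreover have "(\<Sum>u\<in>V. if v = u then real (m u) else 0) = m v"
      using v fin by simp
    ultimately show "(\<Sum>u\<in>V. ?B u v) = d"
      using indeg [OF v] by (simp add: sum.distrib)
  qed (use K Kd in \<open>auto simp: A_def\<close>)
  also have "\<dots> = (\<Sum>S\<in>Pow V. (\<Prod>v\<in>S. real (m v)) * (\<Sum>p | p permutes (V - S). \<Prod>v\<in>V - S. A v (p v)))"
    by (rule prod_permutes_diag_plus [OF fin(1)])
  \<comment> \<open>With loops used exactly on \<open>S\<close>, the rest is a permutation of
    \<open>V - S\<close> along arcs, to which \<open>card_cycle_covers_le\<close> applies.\<close>
  also have "\<dots> \<le> (\<Sum>S\<in>Pow V. (\<Prod>v\<in>S. real (m v)) * (\<Prod>v\<in>V - S. s))"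
  proof (intro sum_mono mult_left_mono prod_nonneg)
    fix S assume "S \<in> Pow V"
    let ?T = "V - S"
    let ?N = "\<lambda>v. N v \<inter> ?T"
    have finT: "finite ?T" using fin by simp
    have "(\<Prod>v\<in>?T. A v (p v)) = (if \<forall>v\<in>?T. p v \<in> ?N v then 1 else 0)" if "p permutes ?T" for p
      using permutes_in_image [OF that] finT by (auto simp: A_def)
    then have "(\<Sum>p | p permutes ?T. \<Prod>v\<in>?T. A v (p v))
        = (\<Sum>p | p permutes ?T. if \<forall>v\<in>?T. p v \<in> ?N v then 1 else 0)"
      by (intro sum.cong) auto
    also have "\<dots> = card {p. p permutes ?T \<and> (\<forall>v\<in>?T. p v \<in> ?N v)}"
      using finite_permutations [OF finT] by (simp flip: sum.inter_filter)
    also have "\<dots> \<le> s ^ card ?T"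
      unfolding s_def
    proof (rule card_cycle_covers_le [OF finT, where N = ?N])
      show "card (?N v) \<le> d" if "v \<in> ?T" for v
      proof -
        have "card (?N v) \<le> card (N v)"
          using that N(1) [of v] fin finite_subset [of "N v" V] by (intro card_mono) auto
        then show ?thesis using outdeg [of v] that by simp
      qed
      show "\<not> r dvd length cs" if "distinct cs" "cs \<noteq> []" "set cs \<subseteq> ?T"
        "\<And>x. x \<in> set cs \<Longrightarrow> cycle_of_list cs x \<in> ?N x" for cs
        using that by (intro no_cycle) auto
    qed (use N r Kd in auto)
    also have "\<dots> = (\<Prod>v\<in>?T. s)" by simp
    finally show "(\<Sum>p | p permutes ?T. \<Prod>v\<in>?T. A v (p v)) \<le> (\<Prod>v\<in>?T. s)" .
  qed simp
  also have "\<dots> = (\<Prod>v\<in>V. m v + s)"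
    using fin by (simp only: prod_add)
  \<comment> \<open>Integrality of \<open>m v < K\<close> gives the slack of 1 that makes the last
    comparison strict.\<close>
  also have "\<dots> \<le> (\<Prod>v\<in>V. (real K - 1) + s)"
    using m \<open>s \<ge> 0\<close> by (intro prod_mono) (fastforce simp: of_nat_less_iff)
  also have "\<dots> < (d / exp 1) ^ card V"
  proof -
    have "s \<le> sqrt (2 * real d * real K)"
      unfolding s_def using r(2) by (simp add: mult_left_mono)
    then have "(real K - 1) + s < d / exp 1"
      using degree_inequality [OF _ d] by simp
    then show ?thesis
      using K n \<open>s \<ge> 0\<close> by (simp add: power_strict_mono)
  qed
  finally show False by simp
qed

section \<open>Edge-disjoint cycles\<close>

lemma (in pre_digraph) cas_map:
  assumes "cs \<noteq> []" "\<And>x. x \<in> set cs \<Longrightarrow> tail G (a x) = x" "map (\<lambda>x. head G (a x)) cs = tl cs @ [w]"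
  shows "cas (hd cs) (map a cs) w \<and> awalk_verts (hd cs) (map a cs) = cs @ [w]"
  using assms
proof (induction cs)
  case (Cons x cs)
  then show ?case by (cases cs) auto
qed simp

text \<open>The arcs \<open>a x\<close> lead from each vertex of the list to its cyclic successor.
  The counts show that their removal lowers in- and outdegrees equally.\<close>

lemma (in pre_digraph) cycle_map:
  assumes cs: "distinct cs" "cs \<noteq> []" "set cs \<subseteq> verts G"
    and a: "\<And>x. x \<in> set cs \<Longrightarrow> a x \<in> arcs G \<and> tail G (a x) = x \<and> head G (a x) = cycle_of_list cs x"
  shows "cycle (map a cs)"
    "card {e \<in> set (map a cs). tail G e = v} = (if v \<in> set cs then 1 else 0)"
    "card {e \<in> set (map a cs). head G e = v} = (if v \<in> set cs then 1 else 0)"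
proof -
  have rot: "map (cycle_of_list cs) cs = tl cs @ [hd cs]"
    using cyclic_rotation [OF cs(1), of 1] cs(2) by (simp add: rotate1_hd_tl)
  have "map (\<lambda>x. head G (a x)) cs = map (cycle_of_list cs) cs"
    using a by simp
  then have walk: "cas (hd cs) (map a cs) (hd cs) \<and> awalk_verts (hd cs) (map a cs) = cs @ [hd cs]"
    using a cs(2) rot by (intro cas_map) auto
  have "distinct (tl cs @ [hd cs])"
    using cs(1,2) by (cases cs) auto
  then show "cycle (map a cs)"
    unfolding cycle_def awalk_def using walk cs a
    by (intro exI [of _ "hd cs"]) auto
  have "{e \<in> set (map a cs). tail G e = v} = (if v \<in> set cs then {a v} else {})"
    using a by auto
  then show "card {e \<in> set (map a cs). tail G e = v} = (if v \<in> set cs then 1 else 0)"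
    by simp
  let ?\<sigma> = "cycle_of_list cs"
  have perm: "?\<sigma> permutes set cs" by (rule cycle_permutes)
  have "{e \<in> set (map a cs). head G e = v} = (if v \<in> set cs then {a (inv_into UNIV ?\<sigma> v)} else {})"
    using a permutes_inverses [OF perm] permutes_in_image [OF perm]
      permutes_in_image [OF permutes_inv [OF perm]] by auto
  then show "card {e \<in> set (map a cs). head G e = v} = (if v \<in> set cs then 1 else 0)"
    by simp
qed

text \<open>Deleting \<open>F\<close> lowers in- and outdegree of \<open>v\<close> by
  \<open>m v\<close>, the deficit that loops fill in \<open>exists_cycle_dvd\<close>. Without
  parallel arcs, arcs can be counted by their ends.\<close>

lemma (in digraph) exists_cycle_avoiding:
  assumes "verts G \<noteq> {}" and reg: "\<And>v. v \<in> verts G \<Longrightarrow> out_degree G v = d \<and> in_degree G v = d"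
    and F: "F \<subseteq> arcs G"
    and m: "\<And>v. v \<in> verts G \<Longrightarrow> card {e \<in> F. tail G e = v} = m v"
      "\<And>v. v \<in> verts G \<Longrightarrow> card {e \<in> F. head G e = v} = m v"
      "\<And>v. v \<in> verts G \<Longrightarrow> m v < K"
    and r: "2 \<le> r" "r - 1 \<le> K" and d: "real d \<ge> exp 1 ^ 3 * real K"
  obtains p where "cycle p" "r dvd length p" "set p \<subseteq> arcs G - F"
    "\<And>v. card {e \<in> set p. tail G e = v} \<le> 1"
    "\<And>v. card {e \<in> set p. head G e = v} = card {e \<in> set p. tail G e = v}"
proof -
  let ?N = "\<lambda>v. head G ` (out_arcs G v - F)"
  have inj: "e = e'" if "e \<in> arcs G" "e' \<in> arcs G" "tail G e = tail G e'" "head G e = head G e'" for e e'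
    using no_multi_arcs [of e e'] that by (simp add: arc_to_ends_def)
  have finF: "finite F" using F finite_arcs by (rule finite_subset)
  obtain cs where cs: "distinct cs" "cs \<noteq> []" "set cs \<subseteq> verts G" "r dvd length cs"
    and cs_arc: "\<And>x. x \<in> set cs \<Longrightarrow> cycle_of_list cs x \<in> ?N x"
  proof (rule exists_cycle_dvd [of "verts G" ?N m d K r])
    fix v assume v: "v \<in> verts G"
    show "?N v \<subseteq> verts G" by (auto simp: out_arcs_def)
    have "card (?N v) = card (out_arcs G v - F)"
      by (rule card_image) (auto simp: inj_on_def out_arcs_def intro: inj)
    also have "\<dots> = card (out_arcs G v - {e \<in> F. tail G e = v})"
      by (rule arg_cong [where f = card]) (auto simp: out_arcs_def)
    also have "\<dots> = card (out_arcs G v) - m v"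
      unfolding m(1) [OF v, symmetric] using F finF
      by (intro card_Diff_subset) (auto simp: out_arcs_def)
    finally have "card (?N v) = d - m v" using reg [OF v] by (simp add: out_degree_def)
    moreover have "m v \<le> d"
      using card_mono [of "out_arcs G v" "{e \<in> F. tail G e = v}"] F reg [OF v] m(1) [OF v]
      by (auto simp: out_degree_def out_arcs_def)
    ultimately show "card (?N v) + m v = d" by simp
    have "{u \<in> verts G. v \<in> ?N u} = tail G ` (in_arcs G v - F)"
      by (auto simp: in_arcs_def out_arcs_def)
    also have "card \<dots> = card (in_arcs G v - F)"
      by (rule card_image) (auto simp: inj_on_def in_arcs_def intro: inj)
    also have "\<dots> = card (in_arcs G v - {e \<in> F. head G e = v})"
      by (rule arg_cong [where f = card]) (auto simp: in_arcs_def)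
    also have "\<dots> = card (in_arcs G v) - m v"
      unfolding m(2) [OF v, symmetric] using F finF
      by (intro card_Diff_subset) (auto simp: in_arcs_def)
    finally show "card {u \<in> verts G. v \<in> ?N u} + m v = d"
      using reg [OF v] \<open>m v \<le> d\<close> by (simp add: in_degree_def)
  next
    show "v \<notin> ?N v" for v
      using no_loops by (auto simp: out_arcs_def)
  qed (use assms in auto)
  have "\<exists>a. \<forall>x\<in>set cs. a x \<in> arcs G - F \<and> tail G (a x) = x \<and> head G (a x) = cycle_of_list cs x"
    using cs_arc by (intro bchoice) (fastforce simp: out_arcs_def)
  then obtain a where a: "\<And>x. x \<in> set cs \<Longrightarrow>
      a x \<in> arcs G - F \<and> tail G (a x) = x \<and> head G (a x) = cycle_of_list cs x"
    by blast
  note cyc = cycle_map [OF cs(1-3), of a]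
  show thesis
    by (rule that [of "map a cs"]) (use a cs(4) cyc in auto)
qed

theorem corollary5p4:
  fixes k d :: nat and G :: "('a, 'b) pre_digraph"
  assumes "k \<ge> 2"
    and "real d \<ge> exp 1 ^ 3 * (real k - 1)"
    and "regular_digraph d G"
  shows "\<exists>C :: nat \<Rightarrow> 'b awalk.
           (\<forall>r \<in> {2..k}. pre_digraph.cycle G (C r) \<and> r dvd length (C r)) \<and>
           disjoint_family_on (\<lambda>r. set (C r)) {2..k}"
proof -
  interpret digraph G using assms(3) by (simp add: regular_digraph_def)
  have reg: "out_degree G v = d \<and> in_degree G v = d" if "v \<in> verts G" for v
    using assms(3) that by (simp add: regular_digraph_def)
  have ne: "verts G \<noteq> {}" using assms(3) by (simp add: regular_digraph_def)
  have d: "real d \<ge> exp 1 ^ 3 * real (k - 1)" using assms(1,2) by (simp add: of_nat_diff)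
  \<comment> \<open>The claim is strengthened so that each chosen cycle uses at most one arc out of
    each vertex and equally many into it. For \<open>j = 1\<close> no cycle is chosen yet.\<close>
  have "\<exists>C. (\<forall>r\<in>{2..j}. cycle (C r) \<and> r dvd length (C r) \<and> set (C r) \<subseteq> arcs G \<and>
          (\<forall>v. card {e \<in> set (C r). tail G e = v} \<le> 1 \<and>
            card {e \<in> set (C r). head G e = v} = card {e \<in> set (C r). tail G e = v})) \<and>
        disjoint_family_on (\<lambda>r. set (C r)) {2..j}" if "1 \<le> j" "j \<le> k" for j
    using that
  proof (induction j rule: dec_induct)
    case base
    then show ?case by (simp add: disjoint_family_on_def)
  next
    case (step j)
    then have "j \<le> k" by simp
    from step.IH [OF this] obtain C where
      C: "\<forall>r\<in>{2..j}. cycle (C r) \<and> r dvd length (C r) \<and> set (C r) \<subseteq> arcs G \<and>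
          (\<forall>v. card {e \<in> set (C r). tail G e = v} \<le> 1 \<and>
            card {e \<in> set (C r). head G e = v} = card {e \<in> set (C r). tail G e = v})"
      and disj: "disjoint_family_on (\<lambda>r. set (C r)) {2..j}"
      by blast
    define F where "F = (\<Union>r\<in>{2..j}. set (C r))"
    define m where "m v = (\<Sum>r\<in>{2..j}. card {e \<in> set (C r). tail G e = v})" for v
    have card_F: "card {e \<in> F. P e} = (\<Sum>r\<in>{2..j}. card {e \<in> set (C r). P e})" for P
    proof -
      have "{e \<in> F. P e} = (\<Union>r\<in>{2..j}. {e \<in> set (C r). P e})" by (auto simp: F_def)
      also have "card \<dots> = (\<Sum>r\<in>{2..j}. card {e \<in> set (C r). P e})"
        by (rule card_UN_disjoint) (use disj in \<open>auto simp: disjoint_family_on_def\<close>)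
      finally show ?thesis .
    qed
    obtain p where p: "cycle p" "Suc j dvd length p" "set p \<subseteq> arcs G - F"
      "\<And>v. card {e \<in> set p. tail G e = v} \<le> 1"
      "\<And>v. card {e \<in> set p. head G e = v} = card {e \<in> set p. tail G e = v}"
    proof (rule exists_cycle_avoiding [OF ne reg, of F m "k - 1" "Suc j"])
      show "F \<subseteq> arcs G" using C by (auto simp: F_def)
      show "card {e \<in> F. tail G e = v} = m v" for v by (simp add: card_F m_def)
      show "card {e \<in> F. head G e = v} = m v" for v
        unfolding card_F m_def using C by (intro sum.cong) auto
      \<comment> \<open>So far \<open>j - 1\<close> cycles are chosen, each passing \<open>v\<close>
        at most once, and \<open>j < k\<close>.\<close>
      show "m v < k - 1" for v
      proof -
        have "m v \<le> (\<Sum>r\<in>{2..j}. 1)"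
          unfolding m_def using C by (intro sum_mono) auto
        also have "\<dots> < k - 1" using step.hyps step.prems by auto
        finally show ?thesis .
      qed
    qed (use step d in auto)
    let ?C = "C(Suc j := p)"
    have j: "{2..Suc j} = insert (Suc j) {2..j}" using step by auto
    show ?case
    proof (intro exI [of _ ?C] conjI)
      show "disjoint_family_on (\<lambda>r. set (?C r)) {2..Suc j}"
        using disj p(3) unfolding j disjoint_family_on_def F_def by auto
    qed (use C p in \<open>auto simp: j\<close>)
  qed
  from this [of k] show ?thesis using assms(1) by auto
qed

end
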